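(* There exists a finite universal constant $c>0$ such that, for $k\in\mathbb N$ and $\lambda\in(0,1)$, for any $P$ with marginal distribution over $\mathcal X=\mathbb R^k$ that is a product distribution with marginals having continuous CDFs, and for $\mathcal F$ the space of axis-aligned rectangles $h$ on $\mathbb R^k$ with $P((x,y):h(x)=1)\ge\lambda$, for all $\epsilon,\delta\in(0,1/2)$, $$\Lambda(\epsilon,\delta)\le c\,\frac k\lambda\log\left(\frac k\delta\log\left(\frac1\epsilon\right)\right)\log\left(\frac k\epsilon\log\left(\frac1\delta\right)\right)\log\left(\frac{\lambda\log(1/\epsilon)}{\epsilon\log(k)}\vee e\right).$$
   Context: Let $\mathcal X=\mathbb R^k$ and $\mathcal Y=\{-1,+1\}$. An axis-aligned rectangle on $\mathbb R^k$ is a classifier of the form $h(x'_1,\ldots,x'_k)=2\prod_{j=1}^k\mathbf 1_{[a_j,b_j]}(x'_j)-1$ for some $a_1,\ldots,a_k,b_1,\ldots,b_k\in\mathbb R$. Notation: $a\vee b=\max\{a,b\}$; when $k=1$, the quantity with $\log(k)=0$ in the denominator is interpreted as $+\infty$. $P$ is a probability measure on $\mathcal X\times\mathcal Y$ satisfying the realizable-case assumption: there is a target function $f^*\in\mathcal F$ with $\mathbb P(Y=f^*(x)\mid X=x)=1$ for all $x\in\mathcal X$, where $(X,Y)\sim P$. The error rate is $\mathrm{er}(h)=P((x,y):h(x)\ne y)$. For a set $\mathcal H$ of classifiers, $\mathrm{DIS}(\mathcal H)=\{x\in\mathcal X:\exists h,g\in\mathcal H,\ h(x)\ne g(x)\}$.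 Let $S_\infty=\{(x_1,y_1),(x_2,y_2),\ldots\}$ be i.i.d. with distribution $P$, $S_m=\{(x_1,y_1),\ldots,(x_m,y_m)\}$ ($S_0=\emptyset$), and suppose $y_i=f^*(x_i)$ for all $i$ (true with probability 1). For a sample $S$, $\mathrm{VS}_{\mathcal F,S}=\{h\in\mathcal F:\forall(x,y)\in S,\ h(x)=y\}$. Let $N(m;S_m)=\sum_{t=1}^m\mathbf 1[x_t\in\mathrm{DIS}(\mathrm{VS}_{\mathcal F,S_{t-1}})]$, the number of labels requested by the CAL active learning algorithm among the first $m$ points. For $n\in\mathbb N$, $M(n;S_\infty)=\min\{m\in\mathbb N:N(m;S_m)=n\}$, or $\infty$ if $\max_mN(m;S_m)<n$. The label complexity of CAL is $$\Lambda(\epsilon,\delta)=\min\Big\{n\in\mathbb N:\mathbb P\Big(\sup_{h\in\mathrm{VS}_{\mathcal F,S_{M(n;S_\infty)}}}\mathrm{er}(h)\le\epsilon\Big)\ge1-\delta\Big\}.$$ *)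

theory Defs
  imports "HOL-Probability.Probability"
begin

text \<open>
  The instance space \<open>\<real>\<^sup>k\<close> is the space of the finite product
  \<open>\<Pi>\<^sub>M j\<in>{..<k}. borel\<close>, so that the dimension \<open>k\<close> can be quantified over inside a formula.
  Labels are the integers \<open>-1\<close> and \<open>1\<close>. Sequences are indexed from \<open>0\<close>: the
  \<open>i\<close>-th sample point (counting from 1) of a data sequence \<open>\<omega>\<close> is \<open>\<omega> (i - 1)\<close>.
\<close>

abbreviation instance_space :: "nat \<Rightarrow> (nat \<Rightarrow> real) measure"
  where "instance_space k \<equiv> \<Pi>\<^sub>M j\<in>{..<k}. (borel :: real measure)"

abbreviation label_space :: "int measure"
  where "label_space \<equiv> count_space {- 1, 1}"

text \<open>
  A product distribution on \<open>\<real>\<^sup>k\<close> all of whose marginals have continuous CDFs.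
\<close>

definition continuous_product_distribution :: "nat \<Rightarrow> (nat \<Rightarrow> real) measure \<Rightarrow> bool"
  where "continuous_product_distribution k D \<longleftrightarrow>
    (\<exists>\<mu>. (\<forall>j<k. real_distribution (\<mu> j) \<and> continuous_on UNIV (cdf (\<mu> j))) \<and>
         D = (\<Pi>\<^sub>M j\<in>{..<k}. \<mu> j))"

definition rectangles :: "nat \<Rightarrow> ((nat \<Rightarrow> real) \<Rightarrow> int) set"
  where "rectangles k = {(\<lambda>x. 2 * (\<Prod>j<k. indicator {a j..b j} (x j)) - 1) | a b. True}"

definition heavy_rectangles ::
    "nat \<Rightarrow> real \<Rightarrow> ((nat \<Rightarrow> real) \<times> int) measure \<Rightarrow> ((nat \<Rightarrow> real) \<Rightarrow> int) set"
  where "heavy_rectangles k lam P =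
    {h \<in> rectangles k. measure P {z \<in> space P. h (fst z) = 1} \<ge> lam}"

definition er :: "('x \<times> int) measure \<Rightarrow> ('x \<Rightarrow> int) \<Rightarrow> real"
  where "er P h = measure P {z \<in> space P. h (fst z) \<noteq> snd z}"

text \<open>
  The condition \<open>\<P>(Y = f(x) | X = x) = 1\<close> for all \<open>x\<close>. Conditional probabilities given \<open>X\<close> are
  determined only up to null sets of the law of \<open>X\<close>; the condition says that \<open>Y = f(X)\<close> holds
  almost surely.
\<close>

definition realizable :: "('x \<times> int) measure \<Rightarrow> ('x \<Rightarrow> int) set \<Rightarrow> bool"
  where "realizable P F \<longleftrightarrow> (\<exists>f\<in>F. AE z in P. snd z = f (fst z))"

definition DIS :: "'x set \<Rightarrow> ('x \<Rightarrow> int) set \<Rightarrow> 'x set"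
  where "DIS X H = {x \<in> X. \<exists>h\<in>H. \<exists>g\<in>H. h x \<noteq> g x}"

definition VS :: "('x \<Rightarrow> int) set \<Rightarrow> ('x \<times> int) set \<Rightarrow> ('x \<Rightarrow> int) set"
  where "VS F S = {h \<in> F. \<forall>(x, y) \<in> S. h x = y}"

text \<open>The first \<open>m\<close> data points; \<open>m = \<infinity>\<close> gives the entire sequence.\<close>

definition sample :: "(nat \<Rightarrow> 'x \<times> int) \<Rightarrow> enat \<Rightarrow> ('x \<times> int) set"
  where "sample \<omega> m = \<omega> ` {i. enat i < m}"

definition num_queries :: "'x set \<Rightarrow> ('x \<Rightarrow> int) set \<Rightarrow> (nat \<Rightarrow> 'x \<times> int) \<Rightarrow> nat \<Rightarrow> nat"
  where "num_queries X F \<omega> m =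
    (\<Sum>t=1..m. of_bool (fst (\<omega> (t - 1)) \<in> DIS X (VS F (sample \<omega> (enat (t - 1))))))"

text \<open>The infimum of the empty set in \<^typ>\<open>enat\<close> is \<open>\<infinity>\<close>.\<close>

definition query_time :: "'x set \<Rightarrow> ('x \<Rightarrow> int) set \<Rightarrow> (nat \<Rightarrow> 'x \<times> int) \<Rightarrow> nat \<Rightarrow> enat"
  where "query_time X F \<omega> n = Inf {enat m | m. m \<ge> 1 \<and> num_queries X F \<omega> m = n}"

text \<open>
  The label complexity of CAL. The data sequence is distributed according to the infinite product
  of \<open>P\<close>, completed so that the event in question need only be measurable up to null sets.
  The supremum is taken in \<^typ>\<open>ereal\<close>, where that of the empty set is \<open>-\<infinity>\<close>; in the realizable
  case the version space is almost surely nonempty.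
\<close>

definition label_complexity ::
    "'x set \<Rightarrow> ('x \<Rightarrow> int) set \<Rightarrow> ('x \<times> int) measure \<Rightarrow> real \<Rightarrow> real \<Rightarrow> enat"
  where "label_complexity X F P \<epsilon> \<delta> = Inf {enat n | n. n \<ge> 1 \<and>
    measure (completion (\<Pi>\<^sub>M i\<in>(UNIV :: nat set). P))
      {\<omega> \<in> space (\<Pi>\<^sub>M i\<in>(UNIV :: nat set). P).
         (SUP h \<in> VS F (sample \<omega> (query_time X F \<omega> n)). ereal (er P h)) \<le> ereal \<epsilon>}
      \<ge> 1 - \<delta>}"

text \<open>
  The logarithm on \<open>(0, \<infinity>]\<close>, with \<open>ln \<infinity> = \<infinity>\<close>. It is used because the quotient by \<open>ln k\<close> in
  the bound is \<open>\<infinity>\<close> for \<open>k = 1\<close>, which is what division by \<open>0\<close> yields in \<^typ>\<open>ereal\<close>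
  for a positive numerator.
\<close>

definition ereal_ln :: "ereal \<Rightarrow> ereal"
  where "ereal_ln x = (if x = \<infinity> then \<infinity> else ereal (ln (real_of_ereal x)))"

end

theory Submission
  imports Defs
begin

text \<open>
  Transform each coordinate by its CDF, so that the marginal is uniform. Consider thin strips along
  the \<open>2k\<close> faces of the target: inside it, and outside it over a core that is slightly smaller than
  the target. A strip of relative thickness \<open>\<rho>\<close> has probability at least \<open>\<rho>\<lambda>/2\<close>, so
  \<open>O(log(k/\<delta>)/(\<rho>\<lambda>))\<close> samples hit all of them. A positive point in an inner strip and a negative
  one in an outer strip confine the corresponding face of every consistent rectangle, so the version
  space lies between two fixed boxes that differ by probability at most \<open>4k\<rho>\<close>. Taking \<open>\<rho>\<close> to be
  \<open>2^-i/(4k)\<close> after \<open>2\<^sup>i T\<close> samples, with \<open>T\<close> of order \<open>(k/\<lambda>) log(k log(1/\<epsilon>)/\<delta>)\<close>, the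
  disagreement regions are covered by fixed sets of probability at most \<open>2\<^sup>-\<^sup>i\<close>. Hence the queries
  among the first \<open>2\<^sup>L T\<close> points are dominated by a sum of independent indicators with mean at most
  \<open>(L + 1) T\<close>, and \<open>L = O(log(1/\<epsilon>))\<close> doublings make the error at most \<open>\<epsilon>\<close>. This even gives a bound
  without the last logarithmic factor.
\<close>

section \<open>Continuous distribution functions\<close>

text \<open>This is the probability integral transform: \<open>cdf \<mu>\<close> is uniformly
  distributed. The larger set has measure at most \<open>d\<close> and the smaller one at least
  \<open>d\<close>, so both bounds are equalities.\<close>

lemma measure_cdf_level_sets:
  assumes "real_distribution \<mu>" and cont: "continuous_on UNIV (cdf \<mu>)" and d: "0 \<le> d" "d \<le> 1"
  shows measure_cdf_le: "measure \<mu> {y. cdf \<mu> y \<le> d} = d"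
    and measure_cdf_less: "measure \<mu> {y. cdf \<mu> y < d} = d"
proof -
  interpret real_distribution \<mu> by fact
  have [measurable]: "cdf \<mu> \<in> borel_measurable borel"
    using cont by (rule borel_measurable_continuous_onI)
  have ivt: "\<exists>y. cdf \<mu> y = e" if "0 < e" "e < 1" for e
  proof -
    have "eventually (\<lambda>x. cdf \<mu> x < e) at_bot" "eventually (\<lambda>x. cdf \<mu> x > e) at_top"
      using order_tendstoD(2)[OF cdf_lim_at_bot, of e] order_tendstoD(1)[OF cdf_lim_at_top_prob, of e]
        that by auto
    then obtain x y where "cdf \<mu> x < e" "cdf \<mu> y > e"
      by (meson eventually_at_bot_linorder eventually_at_top_linorder order_refl)
    moreover from this have "x \<le> y"
      using cdf_nondecreasing[of y x] by linarith
    moreover have "continuous_on {x..y} (cdf \<mu>)"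
      using cont continuous_on_subset by blast
    ultimately show ?thesis
      using IVT'[of "cdf \<mu>" x e y] by auto
  qed
  have up: "measure \<mu> {y. cdf \<mu> y \<le> d} \<le> d"
  proof (cases "d < 1")
    case True
    show ?thesis
    \<comment> \<open>The level \<open>d\<close> may be attained on a whole interval; a point at a
      level \<open>e > d\<close> lies to the right of all of it.\<close>
    proof (rule dense_ge_bounded[OF True])
      fix e assume e: "d < e" "e < 1"
      then obtain y where y: "cdf \<mu> y = e" using ivt d by force
      have "{z. cdf \<mu> z \<le> d} \<subseteq> {..y}"
      proof
        fix z assume "z \<in> {z. cdf \<mu> z \<le> d}"
        then show "z \<in> {..y}"
          using cdf_nondecreasing[of y z] y e by (cases "y \<le> z") auto
      qed
      then have "measure \<mu> {y. cdf \<mu> y \<le> d} \<le> measure \<mu> {..y}"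
        by (intro finite_measure_mono) auto
      then show "measure \<mu> {y. cdf \<mu> y \<le> d} \<le> e"
        using y by (simp add: cdf_def2)
    qed
  qed (use d prob_le_1 in \<open>simp add: order_trans[OF prob_le_1]\<close>)
  have lo: "d \<le> measure \<mu> {y. cdf \<mu> y < d}"
  proof (cases "0 < d")
    case True
    show ?thesis
    proof (rule dense_le_bounded[OF True])
      fix e assume e: "0 < e" "e < d"
      then obtain y where y: "cdf \<mu> y = e" using ivt d by force
      have "{..y} \<subseteq> {z. cdf \<mu> z < d}"
        using cdf_nondecreasing[of _ y] y e by force
      then have "measure \<mu> {..y} \<le> measure \<mu> {y. cdf \<mu> y < d}"
        by (intro finite_measure_mono) auto
      then show "e \<le> measure \<mu> {y. cdf \<mu> y < d}"
        using y by (simp add: cdf_def2)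
    qed
  qed (use d in simp)
  have "measure \<mu> {y. cdf \<mu> y < d} \<le> measure \<mu> {y. cdf \<mu> y \<le> d}"
    by (intro finite_measure_mono) auto
  with up lo show "measure \<mu> {y. cdf \<mu> y \<le> d} = d" "measure \<mu> {y. cdf \<mu> y < d} = d"
    by auto
qed

lemma measure_cdf_intervals:
  assumes "real_distribution \<mu>" "continuous_on UNIV (cdf \<mu>)" and cd: "0 \<le> c" "c \<le> d" "d \<le> 1"
  shows measure_cdf_oo: "measure \<mu> {y. c < cdf \<mu> y \<and> cdf \<mu> y < d} = d - c"
    and measure_cdf_cc: "measure \<mu> {y. c \<le> cdf \<mu> y \<and> cdf \<mu> y \<le> d} = d - c"
proof -
  interpret real_distribution \<mu> by fact
  have [measurable]: "cdf \<mu> \<in> borel_measurable borel"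
    using assms(2) by (rule borel_measurable_continuous_onI)
  note m = measure_cdf_level_sets[OF assms(1,2)]
  show "measure \<mu> {y. c < cdf \<mu> y \<and> cdf \<mu> y < d} = d - c"
  proof (cases "c = d")
    case True
    then have "{y. c < cdf \<mu> y \<and> cdf \<mu> y < d} = {}" by auto
    then show ?thesis using True by (simp only: measure_empty)
  next
    case False
    then have "{y. cdf \<mu> y \<le> c} \<subseteq> {y. cdf \<mu> y < d}" using cd by auto
    moreover have "{y. c < cdf \<mu> y \<and> cdf \<mu> y < d} = {y. cdf \<mu> y < d} - {y. cdf \<mu> y \<le> c}"
      by auto
    ultimately show ?thesis
      using cd m(1)[of c] m(2)[of d] by (simp only:) (subst finite_measure_Diff; simp)
  qed
  have "{y. cdf \<mu> y < c} \<subseteq> {y. cdf \<mu> y \<le> d}" using cd by auto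
  moreover have "{y. c \<le> cdf \<mu> y \<and> cdf \<mu> y \<le> d} = {y. cdf \<mu> y \<le> d} - {y. cdf \<mu> y < c}"
    by auto
  ultimately show "measure \<mu> {y. c \<le> cdf \<mu> y \<and> cdf \<mu> y \<le> d} = d - c"
    using cd m(2)[of c] m(1)[of d] by (simp only:) (subst finite_measure_Diff; simp)
qed

text \<open>Slabs around the faces of the target may protrude from the unit cube. Clipping to
  \<open>[0, 1]\<close> leaves the set unchanged and can only shorten the interval.\<close>

lemma measure_cdf_cc_le:
  assumes "real_distribution \<mu>" "continuous_on UNIV (cdf \<mu>)" and cd: "c \<le> d" "c \<le> 1" "0 \<le> d"
  shows "measure \<mu> {y. c \<le> cdf \<mu> y \<and> cdf \<mu> y \<le> d} \<le> d - c"
proof -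
  interpret real_distribution \<mu> by fact
  have "{y. c \<le> cdf \<mu> y \<and> cdf \<mu> y \<le> d} = {y. max c 0 \<le> cdf \<mu> y \<and> cdf \<mu> y \<le> min d 1}"
    by (auto simp: cdf_nonneg cdf_bounded_prob)
  then show ?thesis
    using measure_cdf_cc[OF assms(1,2), of "max c 0" "min d 1"] cd by auto
qed

section \<open>Independent samples\<close>

context prob_space
begin

abbreviation iid :: "(nat \<Rightarrow> 'a) measure"
  where "iid \<equiv> \<Pi>\<^sub>M i\<in>(UNIV :: nat set). M"

lemma prob_space_iid: "prob_space iid"
  by (intro prob_space_PiM prob_space_axioms)

text \<open>The integrand depends on finitely many coordinates only, so the infinite product reduces
  to a finite one. Both tail bounds below rest on this factorisation.\<close>

lemma nn_integral_iid_prod: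
  assumes [measurable]: "\<And>s. f s \<in> borel_measurable M"
  shows "(\<integral>\<^sup>+\<omega>. (\<Prod>s<T. f s (\<omega> s)) \<partial>iid) = (\<Prod>s<T. \<integral>\<^sup>+z. f s z \<partial>M)"
proof -
  interpret I: product_prob_space "\<lambda>_::nat. M" UNIV
    by standard
  have "(\<integral>\<^sup>+\<omega>. (\<Prod>s<T. f s (\<omega> s)) \<partial>iid)
      = (\<integral>\<^sup>+\<omega>. (\<Prod>s<T. f s (restrict \<omega> {..<T} s)) \<partial>iid)"
    by (intro nn_integral_cong prod.cong) auto
  also have "\<dots> = (\<integral>\<^sup>+\<omega>. (\<Prod>s<T. f s (\<omega> s)) \<partial>distr iid (\<Pi>\<^sub>M s\<in>{..<T}. M) (\<lambda>\<omega>. restrict \<omega> {..<T}))"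
    by (subst nn_integral_distr) (auto intro!: measurable_restrict_subset)
  also have "distr iid (\<Pi>\<^sub>M s\<in>{..<T}. M) (\<lambda>\<omega>. restrict \<omega> {..<T}) = (\<Pi>\<^sub>M s\<in>{..<T}. M)"
    by (intro I.distr_PiM_restrict_finite) auto
  also have "(\<integral>\<^sup>+\<omega>. (\<Prod>s<T. f s (\<omega> s)) \<partial>(\<Pi>\<^sub>M s\<in>{..<T}. M)) = (\<Prod>s<T. \<integral>\<^sup>+z. f s z \<partial>M)"
    by (intro I.product_nn_integral_prod) auto
  finally show ?thesis .
qed

lemma AE_iid:
  assumes "AE z in M. Q z"
  shows "AE \<omega> in iid. \<forall>s. Q (\<omega> s)"
  by (subst AE_all_countable) (intro allI AE_PiM_component prob_space_axioms assms UNIV_I)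

lemma prob_iid_miss:
  assumes [measurable]: "A \<in> sets M"
  shows "measure iid {\<omega> \<in> space iid. \<forall>s<T. \<omega> s \<notin> A} = (1 - prob A) ^ T"
proof -
  interpret I: prob_space iid by (rule prob_space_iid)
  have "emeasure iid {\<omega> \<in> space iid. \<forall>s<T. \<omega> s \<notin> A}
     = (\<integral>\<^sup>+\<omega>. indicator {\<omega> \<in> space iid. \<forall>s<T. \<omega> s \<notin> A} \<omega> \<partial>iid)"
    by (subst nn_integral_indicator) auto
  also have "\<dots> = (\<integral>\<^sup>+\<omega>. (\<Prod>s<T. indicator (space M - A) (\<omega> s)) \<partial>iid)"
    by (intro nn_integral_cong)
      (auto simp: indicator_def space_PiM PiE_iff prod_zero_iff lessThan_def
        intro!: prod.neutral[symmetric])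
  also have "\<dots> = (\<Prod>s<T. \<integral>\<^sup>+z. indicator (space M - A) z \<partial>M)"
    by (intro nn_integral_iid_prod) auto
  also have "\<dots> = ennreal ((1 - prob A) ^ T)"
    by (simp add: emeasure_eq_measure prob_compl ennreal_power)
  finally show ?thesis
    by (simp add: I.emeasure_eq_measure)
qed

lemma prob_iid_miss_le:
  assumes A: "A \<in> sets M" and p: "p \<le> prob A"
  shows "measure iid {\<omega> \<in> space iid. \<forall>s<T. \<omega> s \<notin> A} \<le> exp (- (p * real T))"
proof -
  have "(1 - prob A) ^ T \<le> exp (- p) ^ T"
    using p exp_ge_add_one_self[of "- p"] by (intro power_mono) (auto simp del: exp_ge_add_one_self)
  then show ?thesis
    using prob_iid_miss[OF A] by (simp add: exp_of_nat_mult[symmetric] mult.commute)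
qed

text \<open>A Chernoff bound: \<open>\<E> exp Z \<le> exp ((e - 1) \<E> Z)\<close>, and \<open>e - 1 \<le> 2\<close>.\<close>

lemma prob_iid_count_ge:
  assumes C[measurable]: "\<And>s. C s \<in> sets M"
  shows "measure iid {\<omega> \<in> space iid. x \<le> (\<Sum>s<T. indicator (C s) (\<omega> s) :: real)}
     \<le> exp (2 * (\<Sum>s<T. prob (C s)) - x)"
proof -
  interpret I: prob_space iid by (rule prob_space_iid)
  let ?Z = "\<lambda>\<omega>. \<Sum>s<T. indicator (C s) (\<omega> s) :: real"
  have e: "exp 1 - 1 \<le> (2::real)"
    using exp_le by simp
  have e1: "ennreal (exp 1) = 1 + ennreal (exp 1 - 1)"
    by (simp flip: ennreal_1 ennreal_plus)
  have one: "(\<integral>\<^sup>+z. ennreal (exp (indicator (C s) z)) \<partial>M) \<le> ennreal (exp (2 * prob (C s)))" for s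
  proof -
    \<comment> \<open>The exponential of an indicator is affine in it, so each factor is computed
      exactly.\<close>
    have "(\<integral>\<^sup>+z. ennreal (exp (indicator (C s) z)) \<partial>M)
       = (\<integral>\<^sup>+z. 1 + ennreal (exp 1 - 1) * indicator (C s) z \<partial>M)"
      by (intro nn_integral_cong)
        (auto simp: indicator_def e1)
    also have "\<dots> = 1 + ennreal (exp 1 - 1) * emeasure M (C s)"
      by (subst nn_integral_add)
        (auto simp: nn_integral_cmult_indicator emeasure_space_1)
    also have "\<dots> = ennreal (1 + (exp 1 - 1) * prob (C s))"
      by (simp add: emeasure_eq_measure ennreal_mult' ennreal_plus mult_nonneg_nonneg)
    also have "\<dots> \<le> ennreal (exp (2 * prob (C s)))"
    proof (rule ennreal_leI)
      have "1 + (exp 1 - 1) * prob (C s) \<le> 1 + 2 * prob (C s)"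
        using e by (intro add_left_mono mult_right_mono) auto
      also have "\<dots> \<le> exp (2 * prob (C s))" by (rule exp_ge_add_one_self)
      finally show "1 + (exp 1 - 1) * prob (C s) \<le> exp (2 * prob (C s))" .
    qed
    finally show ?thesis .
  qed
  \<comment> \<open>Exponential Markov inequality; the exponential of the sum then splits into one
    factor per sample.\<close>
  have "emeasure iid {\<omega> \<in> space iid. x \<le> ?Z \<omega>}
     = emeasure iid {\<omega> \<in> space iid. 1 \<le> ennreal (exp (- x)) * ennreal (exp (?Z \<omega>))}"
    by (intro arg_cong2[where f=emeasure] refl)
      (auto simp flip: ennreal_mult' exp_add ennreal_1)
  also have "\<dots> \<le> ennreal (exp (- x)) * (\<integral>\<^sup>+\<omega>. ennreal (exp (?Z \<omega>)) * indicator (space iid) \<omega> \<partial>iid)"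
    by (intro nn_integral_Markov_inequality) auto
  also have "(\<integral>\<^sup>+\<omega>. ennreal (exp (?Z \<omega>)) * indicator (space iid) \<omega> \<partial>iid)
      = (\<integral>\<^sup>+\<omega>. (\<Prod>s<T. ennreal (exp (indicator (C s) (\<omega> s)))) \<partial>iid)"
    by (intro nn_integral_cong) (simp add: exp_sum prod_ennreal)
  also have "\<dots> = (\<Prod>s<T. \<integral>\<^sup>+z. ennreal (exp (indicator (C s) z)) \<partial>M)"
    by (intro nn_integral_iid_prod) auto
  also have "\<dots> \<le> (\<Prod>s<T. ennreal (exp (2 * prob (C s))))"
    by (intro prod_mono_ennreal one)
  also have "\<dots> = ennreal (exp (2 * (\<Sum>s<T. prob (C s))))"
    by (simp add: prod_ennreal exp_sum sum_distrib_left)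
  finally show ?thesis
    by (simp add: I.emeasure_eq_measure mult_left_mono flip: ennreal_mult' exp_add)
qed

end

section \<open>Version spaces of rectangles\<close>

definition rectangle :: "nat \<Rightarrow> (nat \<Rightarrow> real) \<Rightarrow> (nat \<Rightarrow> real) \<Rightarrow> (nat \<Rightarrow> real) \<Rightarrow> int"
  where "rectangle k a b = (\<lambda>x. 2 * (\<Prod>j<k. indicator {a j..b j} (x j)) - 1)"

lemma rectangles_eq: "rectangles k = {rectangle k a b | a b. True}"
  by (simp add: rectangles_def rectangle_def)

lemma rectangle_eq_if:
  "rectangle k a b x = (if \<forall>j<k. a j \<le> x j \<and> x j \<le> b j then 1 else - 1)"
proof (cases "\<forall>j<k. a j \<le> x j \<and> x j \<le> b j")
  case False
  then have "(\<Prod>j<k. indicator {a j..b j} (x j)) = (0::int)"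
    by (intro prod_zero) (auto simp: indicator_def)
  with False show ?thesis by (auto simp: rectangle_def)
qed (simp add: rectangle_def)

lemma rectangle_eq_1_iff: "rectangle k a b x = 1 \<longleftrightarrow> (\<forall>j<k. a j \<le> x j \<and> x j \<le> b j)"
  by (auto simp: rectangle_eq_if)

text \<open>Corners may thus be taken extensional, which makes the set of rational corner vectors
  countable.\<close>

lemma rectangle_restrict: "rectangle k (restrict a {..<k}) (restrict b {..<k}) = rectangle k a b"
  by (auto simp: rectangle_eq_if)

lemma measurable_rectangle[measurable]:
  "rectangle k a b \<in> measurable (instance_space k) (count_space UNIV)"
proof -
  have "Measurable.pred (instance_space k) (\<lambda>x. \<forall>j\<in>{..<k}. a j \<le> x j \<and> x j \<le> b j)"
    by (intro pred_intros_finite) (auto intro!: pred_intros_logic)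
  then show ?thesis
    unfolding rectangle_eq_if[abs_def] by (simp add: Ball_def)
qed

text \<open>Rectangles are closed. Enlargements keep every positive point, and a negative point has
  a positive distance to the rectangle in some coordinate, which the enlargements eventually
  undercut.\<close>

lemma eventually_rectangle_eq:
  assumes a: "\<And>n j. a j - 1 / real (Suc n) < a' n j \<and> a' n j < a j"
    and b: "\<And>n j. b j < b' n j \<and> b' n j < b j + 1 / real (Suc n)"
  shows "\<forall>\<^sub>F n in sequentially. rectangle k (a' n) (b' n) x = rectangle k a b x"
proof (cases "\<forall>j<k. a j \<le> x j \<and> x j \<le> b j")
  case True
  have "a' n j \<le> x j \<and> x j \<le> b' n j" if "j < k" for n j
    using True a[of j n] b[of j n] that by fastforce
  with True show ?thesis by (auto simp: rectangle_eq_if)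
next
  case False
  then obtain j where j: "j < k" "x j < a j \<or> b j < x j" by force
  define d where "d = max (a j - x j) (x j - b j)"
  have "d > 0" using j by (auto simp: d_def)
  then have "\<forall>\<^sub>F n in sequentially. 1 / real (Suc n) < d"
    by (intro order_tendstoD(2)[OF LIMSEQ_Suc[OF lim_1_over_n]])
  then show ?thesis
  proof eventually_elim
    case (elim n)
    then have "x j < a' n j \<or> b' n j < x j"
      using a[of j n] b[of j n] by (auto simp: d_def)
    with j have "\<not> (\<forall>j<k. a' n j \<le> x j \<and> x j \<le> b' n j)" by force
    with False show ?case by (auto simp: rectangle_eq_if)
  qed
qed

section \<open>Version spaces, query counts and query times along a data sequence\<close>

lemma VS_antimono: "S \<subseteq> T \<Longrightarrow> VS F T \<subseteq> VS F S"
  by (auto simp: VS_def)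

lemma sample_mono: "m \<le> n \<Longrightarrow> sample \<omega> m \<subseteq> sample \<omega> n"
  by (auto simp: sample_def intro: order_less_le_trans)

lemma VS_sample_antimono: "m \<le> n \<Longrightarrow> VS F (sample \<omega> n) \<subseteq> VS F (sample \<omega> m)"
  by (intro VS_antimono sample_mono)

lemma in_VS_sample_iff:
  "h \<in> VS F (sample \<omega> (enat m)) \<longleftrightarrow> h \<in> F \<and> (\<forall>i<m. h (fst (\<omega> i)) = snd (\<omega> i))"
  by (auto simp: VS_def sample_def split_beta)

lemma finite_sample: "finite (sample \<omega> (enat m))"
  by (simp add: sample_def)

lemma num_queries_mono: "m \<le> m' \<Longrightarrow> num_queries X F \<omega> m \<le> num_queries X F \<omega> m'"
  unfolding num_queries_def by (intro sum_mono2) auto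

text \<open>Shifted to indices from 0: the point \<open>\<omega> s\<close> is judged by exactly the
  \<open>s\<close> points before it.\<close>

lemma num_queries_eq:
  "num_queries X F \<omega> m = (\<Sum>s<m. of_bool (fst (\<omega> s) \<in> DIS X (VS F (sample \<omega> (enat s)))))"
  unfolding num_queries_def
  by (rule sum.reindex_bij_witness[of _ Suc "\<lambda>t. t - 1"]) auto

lemma query_time_cases:
  obtains m where "m \<ge> 1" "num_queries X F \<omega> m = n" "query_time X F \<omega> n = enat m"
    "\<And>m'. m' \<ge> 1 \<Longrightarrow> num_queries X F \<omega> m' = n \<Longrightarrow> m \<le> m'"
  | "query_time X F \<omega> n = \<infinity>" "\<And>m. m \<ge> 1 \<Longrightarrow> num_queries X F \<omega> m \<noteq> n"
proof (cases "\<exists>m\<ge>1. num_queries X F \<omega> m = n")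
  case True
  define m where "m = (LEAST m. m \<ge> 1 \<and> num_queries X F \<omega> m = n)"
  have m: "m \<ge> 1 \<and> num_queries X F \<omega> m = n"
    unfolding m_def by (rule LeastI_ex) (use True in blast)
  have le: "m \<le> m'" if "m' \<ge> 1" "num_queries X F \<omega> m' = n" for m'
    unfolding m_def by (rule Least_le) (use that in blast)
  have "query_time X F \<omega> n = enat m"
    unfolding query_time_def
    by (rule antisym, rule Inf_lower) (use m le in \<open>auto intro!: Inf_greatest\<close>)
  then show thesis using m by (intro that(1)[of m] le) auto
next
  case False
  then have "query_time X F \<omega> n = \<infinity>"
    by (auto simp: query_time_def top_enat_def Inf_enat_def)
  then show thesis using False by (intro that(2)) auto
qed

text \<open>The event inside the label complexity without the \<open>ereal\<close> supremum. An
  empty version space satisfies it, in accordance with a supremum of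
  \<open>-\<infinity>\<close>.\<close>

definition VS_error_le ::
    "('x \<Rightarrow> int) set \<Rightarrow> ('x \<times> int) measure \<Rightarrow> real \<Rightarrow> (nat \<Rightarrow> 'x \<times> int) \<Rightarrow> enat \<Rightarrow> bool"
  where "VS_error_le F P \<epsilon> \<omega> m \<longleftrightarrow> (\<forall>h \<in> VS F (sample \<omega> m). er P h \<le> \<epsilon>)"

lemma SUP_er_le_iff:
  "(SUP h \<in> VS F (sample \<omega> m). ereal (er P h)) \<le> ereal \<epsilon> \<longleftrightarrow> VS_error_le F P \<epsilon> \<omega> m"
  by (simp add: SUP_le_iff VS_error_le_def)

lemma VS_error_le_mono: "VS_error_le F P \<epsilon> \<omega> m \<Longrightarrow> m \<le> m' \<Longrightarrow> VS_error_le F P \<epsilon> \<omega> m'"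
  using VS_sample_antimono unfolding VS_error_le_def by blast

section \<open>Measurability through countably many rational rectangles\<close>

locale rectangle_learning = prob_space P
  for k :: nat and lam :: real and P :: "((nat \<Rightarrow> real) \<times> int) measure" +
  assumes sets_P: "sets P = sets (instance_space k \<Otimes>\<^sub>M label_space)"
begin

abbreviation X :: "(nat \<Rightarrow> real) set"
  where "X \<equiv> space (instance_space k)"

abbreviation F :: "((nat \<Rightarrow> real) \<Rightarrow> int) set"
  where "F \<equiv> heavy_rectangles k lam P"

definition rational_rectangles :: "((nat \<Rightarrow> real) \<Rightarrow> int) set"
  where "rational_rectangles =
    F \<inter> (\<lambda>(a, b). rectangle k a b) ` (({..<k} \<rightarrow>\<^sub>E \<rat>) \<times> ({..<k} \<rightarrow>\<^sub>E \<rat>))"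

lemma space_P: "space P = X \<times> {- 1, 1}"
  using sets_eq_imp_space_eq[OF sets_P] by (simp add: space_pair_measure)

lemma measurable_fst_P[measurable]: "fst \<in> P \<rightarrow>\<^sub>M instance_space k"
  by (subst measurable_cong_sets[OF sets_P refl]) (rule measurable_fst)

lemma measurable_snd_P[measurable]: "snd \<in> P \<rightarrow>\<^sub>M count_space UNIV"
proof -
  have "snd \<in> P \<rightarrow>\<^sub>M label_space"
    by (subst measurable_cong_sets[OF sets_P refl]) (rule measurable_snd)
  moreover have "(\<lambda>l. l) \<in> label_space \<rightarrow>\<^sub>M count_space UNIV" by simp
  ultimately show ?thesis by (rule measurable_compose)
qed

lemma heavy_rectangleE:
  assumes "h \<in> F"
  obtains a b where "h = rectangle k a b"
  using assms by (auto simp: heavy_rectangles_def rectangles_eq)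

lemma measurable_heavy:
  assumes "h \<in> F"
  shows "h \<in> measurable (instance_space k) (count_space UNIV)"
  using assms by (auto elim!: heavy_rectangleE)

lemma countable_rational_rectangles: "countable rational_rectangles"
  unfolding rational_rectangles_def
  by (intro countable_Int2 countable_image countable_SIGMA countable_PiE countable_rat) auto

lemma rational_rectangles_subset: "rational_rectangles \<subseteq> F"
  by (simp add: rational_rectangles_def)

lemma rectangle_heavyI:
  assumes "rectangle k a b \<in> F" and "\<And>j. j < k \<Longrightarrow> a' j \<le> a j \<and> b j \<le> b' j"
  shows "rectangle k a' b' \<in> F"
proof -
  have "measure P {z \<in> space P. rectangle k a b (fst z) = 1}
      \<le> measure P {z \<in> space P. rectangle k a' b' (fst z) = 1}"
    by (intro finite_measure_mono)
      (auto simp: rectangle_eq_1_iff intro: order_trans[OF assms(2)[THEN conjunct1]]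
        order_trans[OF _ assms(2)[THEN conjunct2]])
  with assms(1) show ?thesis
    by (auto simp: heavy_rectangles_def rectangles_eq)
qed

text \<open>
  Enlarging a rectangle slightly keeps it heavy, keeps its positive points, and, for finitely many
  points, also its negative ones. Hence rational rectangles suffice for finite samples.
\<close>

lemma rational_approximation:
  assumes h: "h \<in> F" and A: "finite A" and e: "e < er P h"
  obtains g where "g \<in> rational_rectangles" "\<And>x. x \<in> A \<Longrightarrow> g x = h x" "e < er P g"
proof -
  obtain a b where hab: "h = rectangle k a b" using h by (rule heavy_rectangleE)
  define r :: "real \<Rightarrow> real \<Rightarrow> real" where "r x y = (SOME q. q \<in> \<rat> \<and> x < q \<and> q < y)" for x y
  have r: "r x y \<in> \<rat> \<and> x < r x y \<and> r x y < y" if "x < y" for x y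
    unfolding r_def by (rule someI_ex) (use Rats_dense_in_real[OF that] in blast)
  define a' where "a' n j = r (a j - 1 / real (Suc n)) (a j)" for n j
  define b' where "b' n j = r (b j) (b j + 1 / real (Suc n))" for n j
  have a': "a' n j \<in> \<rat>" "a j - 1 / real (Suc n) < a' n j \<and> a' n j < a j" for n j
    using r[of "a j - 1 / real (Suc n)" "a j"] by (auto simp: a'_def)
  have b': "b' n j \<in> \<rat>" "b j < b' n j \<and> b' n j < b j + 1 / real (Suc n)" for n j
    using r[of "b j" "b j + 1 / real (Suc n)"] by (auto simp: b'_def)
  define g where "g n = rectangle k (a' n) (b' n)" for n
  have gF: "g n \<in> F" for n
    unfolding g_def using h[unfolded hab]
    by (rule rectangle_heavyI) (use a'(2)[of _ n] b'(2)[of _ n] in \<open>simp add: less_imp_le\<close>)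
  have gQ: "g n \<in> rational_rectangles" for n
    unfolding rational_rectangles_def
  proof (intro IntI gF image_eqI)
    show "g n = (\<lambda>(a, b). rectangle k a b) (restrict (a' n) {..<k}, restrict (b' n) {..<k})"
      by (simp add: g_def rectangle_restrict)
  qed (use a'(1) b'(1) in simp)
  have ev: "\<forall>\<^sub>F n in sequentially. g n x = h x" for x
    unfolding g_def hab by (rule eventually_rectangle_eq[OF a'(2) b'(2)])
  have [measurable]: "h \<in> measurable (instance_space k) (count_space UNIV)"
    "g n \<in> measurable (instance_space k) (count_space UNIV)" for n
    using h gF by (auto intro: measurable_heavy)
  \<comment> \<open>\<open>E n\<close> collects the errors of \<open>h\<close> at points where the
    approximations have settled from index \<open>n\<close> on. These sets increase to the whole
    error set of \<open>h\<close>, so continuity from below carries the strict bound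
    \<open>e\<close> over to some \<open>g n\<close>.\<close>
  define E where "E n = {z \<in> space P. (\<forall>m\<ge>n. g m (fst z) = h (fst z)) \<and> h (fst z) \<noteq> snd z}" for n
  have [measurable]: "E n \<in> sets P" for n
    unfolding E_def by measurable
  have "(\<lambda>n. measure P (E n)) \<longlonglongrightarrow> measure P (\<Union>n. E n)"
    by (intro finite_Lim_measure_incseq) (auto simp: incseq_def E_def)
  also have "(\<Union>n. E n) = {z \<in> space P. h (fst z) \<noteq> snd z}"
  proof (intro set_eqI iffI)
    fix z assume "z \<in> {z \<in> space P. h (fst z) \<noteq> snd z}"
    moreover obtain n where "\<forall>m\<ge>n. g m (fst z) = h (fst z)"
      using ev[of "fst z"] unfolding eventually_sequentially by blast
    ultimately show "z \<in> (\<Union>n. E n)" by (auto simp: E_def)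
  qed (auto simp: E_def)
  finally have "(\<lambda>n. measure P (E n)) \<longlonglongrightarrow> er P h"
    by (simp add: er_def)
  then have "\<forall>\<^sub>F n in sequentially. e < measure P (E n)"
    using e by (rule order_tendstoD)
  moreover have "\<forall>\<^sub>F n in sequentially. \<forall>x\<in>A. g n x = h x"
    using A ev by (intro eventually_ball_finite) auto
  ultimately have "\<forall>\<^sub>F n in sequentially. e < measure P (E n) \<and> (\<forall>x\<in>A. g n x = h x)"
    by eventually_elim auto
  then obtain n where n: "e < measure P (E n)" "\<forall>x\<in>A. g n x = h x"
    by (auto simp: eventually_sequentially)
  have "measure P (E n) \<le> er P (g n)"
    unfolding er_def by (intro finite_measure_mono) (auto simp: E_def)
  with n(1) have "e < er P (g n)" by linarith
  show thesis
  proof (rule that[OF gQ _ \<open>e < er P (g n)\<close>])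
    fix x assume "x \<in> A"
    then show "g n x = h x" by (rule n(2)[rule_format])
  qed
qed

lemma er_nonneg: "0 \<le> er P h"
  by (simp add: er_def)

text \<open>Besides the sample one more point \<open>x\<close> keeps its label; it will be the point
  whose query is being decided.\<close>

lemma rational_VS_approximation:
  assumes h: "h \<in> VS F S" and S: "finite S" and e: "e < er P h"
  obtains g where "g \<in> VS rational_rectangles S" "g x = h x" "e < er P g"
proof -
  have hF: "h \<in> F" "finite (insert x (fst ` S))" using h S by (auto simp: VS_def)
  show thesis
  proof (rule rational_approximation[OF hF e])
    fix g assume g: "g \<in> rational_rectangles" "\<And>y. y \<in> insert x (fst ` S) \<Longrightarrow> g y = h y" "e < er P g"
    have "g y = l" if "(y, l) \<in> S" for y l
    proof -
      have "y \<in> insert x (fst ` S)" using that by force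
      with g(2) h that show ?thesis by (auto simp: VS_def)
    qed
    with g(1) have "g \<in> VS rational_rectangles S"
      by (auto simp: VS_def)
    from this g(2)[OF insertI1] g(3) show thesis by (rule that[of g])
  qed
qed

lemma DIS_VS_iff_rational:
  assumes "finite S" "x \<in> X"
  shows "x \<in> DIS X (VS F S) \<longleftrightarrow>
    (\<exists>h\<in>VS rational_rectangles S. \<exists>g\<in>VS rational_rectangles S. h x \<noteq> g x)"
proof
  assume "x \<in> DIS X (VS F S)"
  then obtain h g where hg: "h \<in> VS F S" "g \<in> VS F S" "h x \<noteq> g x"
    by (auto simp: DIS_def)
  \<comment> \<open>Only the labels matter here, so the error threshold is set to a trivial
    value.\<close>
  have "- 1 < er P h" "- 1 < er P g"
    using er_nonneg[of h] er_nonneg[of g] by linarith+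
  obtain h' where h': "h' \<in> VS rational_rectangles S" "h' x = h x"
    by (rule rational_VS_approximation[OF hg(1) assms(1) \<open>- 1 < er P h\<close>])
  obtain g' where g': "g' \<in> VS rational_rectangles S" "g' x = g x"
    by (rule rational_VS_approximation[OF hg(2) assms(1) \<open>- 1 < er P g\<close>])
  show "\<exists>h\<in>VS rational_rectangles S. \<exists>g\<in>VS rational_rectangles S. h x \<noteq> g x"
    by (rule bexI[OF _ h'(1)], rule bexI[OF _ g'(1)]) (simp add: h'(2) g'(2) hg(3))
next
  assume "\<exists>h\<in>VS rational_rectangles S. \<exists>g\<in>VS rational_rectangles S. h x \<noteq> g x"
  then obtain h g where hg: "h \<in> VS rational_rectangles S" "g \<in> VS rational_rectangles S"
    "h x \<noteq> g x" by (elim bexE)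
  have "VS rational_rectangles S \<subseteq> VS F S"
    using rational_rectangles_subset by (auto simp: VS_def)
  then show "x \<in> DIS X (VS F S)"
    unfolding DIS_def
    by (intro CollectI conjI assms(2) bexI[OF _ subsetD[OF _ hg(1)]] bexI[OF _ subsetD[OF _ hg(2)]] hg(3))
qed

lemma VS_error_le_iff_rational:
  "VS_error_le F P \<epsilon> \<omega> (enat m)
    \<longleftrightarrow> (\<forall>h\<in>rational_rectangles. (\<forall>i<m. h (fst (\<omega> i)) = snd (\<omega> i)) \<longrightarrow> er P h \<le> \<epsilon>)"
proof
  assume r: "\<forall>h\<in>rational_rectangles. (\<forall>i<m. h (fst (\<omega> i)) = snd (\<omega> i)) \<longrightarrow> er P h \<le> \<epsilon>"
  show "VS_error_le F P \<epsilon> \<omega> (enat m)"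
    unfolding VS_error_le_def
  proof (intro ballI leI notI)
    fix h assume h: "h \<in> VS F (sample \<omega> (enat m))" "\<epsilon> < er P h"
    obtain g where "g \<in> VS rational_rectangles (sample \<omega> (enat m))" "\<epsilon> < er P g"
      using rational_VS_approximation[OF h(1) finite_sample h(2)] by blast
    with r show False by (auto simp: in_VS_sample_iff)
  qed
next
  assume "VS_error_le F P \<epsilon> \<omega> (enat m)"
  then show "\<forall>h\<in>rational_rectangles. (\<forall>i<m. h (fst (\<omega> i)) = snd (\<omega> i)) \<longrightarrow> er P h \<le> \<epsilon>"
    using rational_rectangles_subset by (auto simp: VS_error_le_def in_VS_sample_iff)
qed

lemma measurable_consistent:
  assumes "h \<in> rational_rectangles"
  shows "Measurable.pred iid (\<lambda>\<omega>. \<forall>i<m. h (fst (\<omega> i)) = snd (\<omega> i))"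
proof -
  have [measurable]: "h \<in> measurable (instance_space k) (count_space UNIV)"
    using assms rational_rectangles_subset by (auto intro: measurable_heavy)
  show ?thesis by measurable
qed

lemma measurable_VS_error_le[measurable]:
  "Measurable.pred iid (\<lambda>\<omega>. VS_error_le F P \<epsilon> \<omega> (enat m))"
  unfolding VS_error_le_iff_rational
  by (intro measurable_pred_countable pred_intros_logic measurable_consistent
      countable_rational_rectangles) auto

text \<open>Whether a query is made depends on finitely many points, so the uncountable version
  space may be replaced by its rational members.\<close>

lemma measurable_query[measurable]:
  "Measurable.pred iid (\<lambda>\<omega>. fst (\<omega> s) \<in> DIS X (VS F (sample \<omega> (enat s))))"
proof -
  have "Measurable.pred iid (\<lambda>\<omega>. \<exists>h\<in>rational_rectangles. \<exists>g\<in>rational_rectangles.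
     (\<forall>i<s. h (fst (\<omega> i)) = snd (\<omega> i)) \<and> (\<forall>i<s. g (fst (\<omega> i)) = snd (\<omega> i))
     \<and> h (fst (\<omega> s)) \<noteq> g (fst (\<omega> s)))"
  proof (intro measurable_pred_countable countable_rational_rectangles pred_intros_logic
      measurable_consistent)
    fix h g assume "h \<in> rational_rectangles" "g \<in> rational_rectangles"
    then have [measurable]: "h \<in> measurable (instance_space k) (count_space UNIV)"
      "g \<in> measurable (instance_space k) (count_space UNIV)"
      using rational_rectangles_subset by (auto intro: measurable_heavy)
    show "Measurable.pred iid (\<lambda>\<omega>. h (fst (\<omega> s)) = g (fst (\<omega> s)))"
      by measurable
  qed auto
  also have "?this \<longleftrightarrow> ?thesis"
  proof (rule measurable_cong)
    fix \<omega> assume "\<omega> \<in> space iid"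
    then have "\<omega> s \<in> space P" by (auto simp: space_PiM)
    then have "fst (\<omega> s) \<in> X" unfolding space_P by (rule mem_Times_iff[THEN iffD1, THEN conjunct1])
    then show "(\<exists>h\<in>rational_rectangles. \<exists>g\<in>rational_rectangles.
       (\<forall>i<s. h (fst (\<omega> i)) = snd (\<omega> i)) \<and> (\<forall>i<s. g (fst (\<omega> i)) = snd (\<omega> i))
       \<and> h (fst (\<omega> s)) \<noteq> g (fst (\<omega> s))) \<longleftrightarrow> fst (\<omega> s) \<in> DIS X (VS F (sample \<omega> (enat s)))"
      by (subst DIS_VS_iff_rational[OF finite_sample]) (auto simp: Bex_def in_VS_sample_iff)
  qed
  finally show ?thesis .
qed

lemma measurable_num_queries[measurable]:
  "(\<lambda>\<omega>. num_queries X F \<omega> m) \<in> measurable iid (count_space UNIV)"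
  unfolding num_queries_eq of_bool_def by measurable

text \<open>
  The event defining the label complexity may fail to be measurable only where the number of
  queries stays bounded and the version space of the whole sequence contains a classifier of large
  error; the latter happens with probability \<open>0\<close> under the consistency assumption below.
\<close>

lemma measure_completion_query_time:
  assumes consistent: "\<And>\<eta>. 0 < \<eta> \<Longrightarrow>
    \<exists>T. measure iid {\<omega> \<in> space iid. VS_error_le F P \<epsilon> \<omega> (enat T)} \<ge> 1 - \<eta>"
  shows "measure (completion iid)
      {\<omega> \<in> space iid. VS_error_le F P \<epsilon> \<omega> (query_time X F \<omega> n)}
    = measure iid {\<omega> \<in> space iid. \<forall>m\<ge>1. num_queries X F \<omega> m = n \<longrightarrow> VS_error_le F P \<epsilon> \<omega> (enat m)}"
    (is "measure _ ?A = measure _ ?B")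
proof -
  interpret I: prob_space iid by (rule prob_space_iid)
  let ?N = "{\<omega> \<in> space iid. \<forall>m. \<not> VS_error_le F P \<epsilon> \<omega> (enat m)}"
  have B[measurable]: "?B \<in> sets iid" and N[measurable]: "?N \<in> sets iid" by measurable
  have "I.prob ?N \<le> \<eta>" if \<eta>: "0 < \<eta>" for \<eta>
  proof -
    obtain T where T: "I.prob {\<omega> \<in> space iid. VS_error_le F P \<epsilon> \<omega> (enat T)} \<ge> 1 - \<eta>"
      using consistent[OF \<eta>] by blast
    have "I.prob ?N \<le> I.prob (space iid - {\<omega> \<in> space iid. VS_error_le F P \<epsilon> \<omega> (enat T)})"
      by (intro I.finite_measure_mono) auto
    also have "\<dots> \<le> \<eta>"
      using T by (subst I.prob_compl) auto
    finally show ?thesis .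
  qed
  then have "I.prob ?N \<le> 0" by (rule field_le_epsilon[where y=0, simplified])
  then have "I.prob ?N = 0" using measure_nonneg[of iid ?N] by linarith
  then have "?N \<in> null_sets iid"
    using N by (auto simp: null_sets_def I.emeasure_eq_measure)
  \<comment> \<open>The sets can differ only where the \<open>n\<close>-th query never occurs, for
    there \<open>?B\<close> holds vacuously. If even the version space of the whole sequence has
    large error, so has that of every finite prefix, by monotonicity.\<close>
  moreover have "?B - ?A \<subseteq> ?N"
  proof
    fix \<omega> assume \<omega>: "\<omega> \<in> ?B - ?A"
    then show "\<omega> \<in> ?N"
    proof (cases rule: query_time_cases[of X F \<omega> n])
      case 2
      then have "\<not> VS_error_le F P \<epsilon> \<omega> \<infinity>" using \<omega> by auto
      then show ?thesis using VS_error_le_mono[of F P \<epsilon> \<omega> _ \<infinity>] \<omega> by auto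
    qed auto
  qed
  ultimately have null: "?B - ?A \<in> null_sets (completion iid)"
    by (rule null_sets_completion_subset[OF _ null_sets_completionI, rotated])
  have "?A \<subseteq> ?B"
  proof
    fix \<omega> assume \<omega>: "\<omega> \<in> ?A"
    show "\<omega> \<in> ?B"
    proof (cases rule: query_time_cases[of X F \<omega> n])
      case (1 m)
      then show ?thesis
        using \<omega> VS_error_le_mono[of F P \<epsilon> \<omega> "enat m"] by auto
    qed (use \<omega> in auto)
  qed
  then have "?A = ?B - (?B - ?A)" by blast
  then have "measure (completion iid) ?A = measure (completion iid) (?B - (?B - ?A))" by simp
  also have "\<dots> = measure (completion iid) ?B"
    using null B by (intro measure_Diff_null_set) auto
  finally show ?thesis by simp
qed

end

section \<open>Confining the version space\<close>

text \<open>Isolates the one side in which a strip differs from its reference box.\<close>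

lemma prod_fun_upd_split:
  fixes g :: "nat \<Rightarrow> real"
  assumes "j < n" and "\<And>i. i < n \<Longrightarrow> i \<noteq> j \<Longrightarrow> g' i = g i"
  shows "(\<Prod>i<n. g' i) = g' j * (\<Prod>i\<in>{..<n} - {j}. g i)"
proof -
  have "(\<Prod>i<n. g' i) = g' j * (\<Prod>i\<in>{..<n} - {j}. g' i)"
    using assms(1) by (intro prod.remove) auto
  also have "(\<Prod>i\<in>{..<n} - {j}. g' i) = (\<Prod>i\<in>{..<n} - {j}. g i)"
    using assms(2) by (intro prod.cong) auto
  finally show ?thesis .
qed

text \<open>A target rectangle with corners \<open>a\<close>, \<open>b\<close> is fixed. The laws
  \<open>\<mu> j\<close> are regular for every index \<open>j\<close>, which makes the facts about
  distribution functions available without side conditions.\<close>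

locale product_rectangle_learning = rectangle_learning k lam P
  for k lam P +
  fixes \<mu> :: "nat \<Rightarrow> real measure" and a b :: "nat \<Rightarrow> real"
  assumes real_distribution: "\<And>j. real_distribution (\<mu> j)"
    and continuous_cdf: "\<And>j. continuous_on UNIV (cdf (\<mu> j))"
    and marginal: "distr P (instance_space k) fst = (\<Pi>\<^sub>M j\<in>{..<k}. \<mu> j)"
    and k_pos: "k \<ge> 1"
    and lam_pos: "0 < lam"
    and target_heavy: "rectangle k a b \<in> F"
    and labels: "AE z in P. snd z = rectangle k a b (fst z)"
begin

sublocale \<mu>: real_distribution "\<mu> j" for j
  by (rule real_distribution)

lemma measurable_cdf[measurable]: "cdf (\<mu> j) \<in> borel_measurable borel"
  using continuous_cdf by (rule borel_measurable_continuous_onI)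

abbreviation "f \<equiv> rectangle k a b"

text \<open>
  All regions below are described through the uniformly distributed coordinates \<open>U j (x j)\<close>,
  in which the target is the box with sides \<open>[lo j, hi j]\<close>, up to null sets.
\<close>

abbreviation "U j \<equiv> cdf (\<mu> j)"

definition "lo j = U j (a j)"
definition "hi j = U j (b j)"
definition "width j = hi j - lo j"

lemma U_less_imp: "U j y < U j y' \<Longrightarrow> y < y'"
  using \<mu>.cdf_nondecreasing[of y' y j] by (cases "y < y'") auto

lemma lo_nonneg: "0 \<le> lo j" and hi_le_1: "hi j \<le> 1"
  by (auto simp: lo_def hi_def \<mu>.cdf_nonneg \<mu>.cdf_bounded_prob)

section \<open>Product formulas for boxes and the side widths of the target\<close>

lemma sets_coordinates[measurable]:
  assumes [measurable]: "\<And>j. j < k \<Longrightarrow> S j \<in> sets borel"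
  shows "{z \<in> space P. \<forall>j<k. fst z j \<in> S j} \<in> sets P"
proof -
  have "{z \<in> space P. \<forall>j\<in>{..<k}. fst z j \<in> S j} \<in> sets P"
    by measurable
  then show ?thesis by (simp add: Ball_def)
qed

lemma prob_coordinates:
  assumes S: "\<And>j. j < k \<Longrightarrow> S j \<in> sets borel"
  shows "prob {z \<in> space P. \<forall>j<k. fst z j \<in> S j} = (\<Prod>j<k. measure (\<mu> j) (S j))"
proof -
  interpret I: finite_product_prob_space \<mu> "{..<k}"
    by standard auto
  have "{z \<in> space P. \<forall>j<k. fst z j \<in> S j} = fst -` (Pi\<^sub>E {..<k} S) \<inter> space P"
    using space_P by (auto simp: PiE_iff space_PiM)
  moreover have "Pi\<^sub>E {..<k} S \<in> sets (instance_space k)"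
    using S by (intro sets_PiM_I_finite) auto
  ultimately have "prob {z \<in> space P. \<forall>j<k. fst z j \<in> S j}
      = measure (distr P (instance_space k) fst) (Pi\<^sub>E {..<k} S)"
    by (simp add: measure_distr)
  also have "\<dots> = (\<Prod>j<k. measure (\<mu> j) (S j))"
    unfolding marginal using S by (intro I.prob_times) auto
  finally show ?thesis .
qed

lemma prob_coordinate:
  assumes "j < k" and [measurable]: "S \<in> sets borel"
  shows "prob {z \<in> space P. fst z j \<in> S} = measure (\<mu> j) S"
proof -
  have "{z \<in> space P. fst z j \<in> S} = {z \<in> space P. \<forall>i<k. fst z i \<in> (if i = j then S else UNIV)}"
    using assms by (auto split: if_splits)
  also have "prob \<dots> = (\<Prod>i<k. measure (\<mu> i) (if i = j then S else UNIV))"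
    by (rule prob_coordinates) auto
  also have "\<dots> = (\<Prod>i<k. if i = j then measure (\<mu> i) S else 1)"
    using \<mu>.prob_space by (intro prod.cong) auto
  also have "\<dots> = measure (\<mu> j) S"
    using assms(1) by simp
  finally show ?thesis .
qed

text \<open>A continuous CDF has no atoms, so the closed side weighs as much as the half-open one.
  The \<open>max\<close> covers empty and one-point sides.\<close>

lemma measure_side: "measure (\<mu> j) {a j..b j} = max 0 (width j)"
proof -
  have "isCont (U j) x" for x
    using continuous_cdf[of j] by (simp add: continuous_on_eq_continuous_at)
  then have null: "measure (\<mu> j) {x} = 0" for x
    by (simp add: \<mu>.isCont_cdf)
  show ?thesis
  proof (cases "a j < b j")
    case True
    then have "{a j..b j} = {a j} \<union> {a j<..b j}" by auto
    also have "measure (\<mu> j) \<dots> = measure (\<mu> j) {a j} + measure (\<mu> j) {a j<..b j}"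
      by (intro \<mu>.finite_measure_Union) auto
    also have "\<dots> = width j"
      using True by (simp add: null width_def hi_def lo_def \<mu>.cdf_diff_eq)
    finally show ?thesis using measure_nonneg[of "\<mu> j" "{a j..b j}"] by simp
  next
    case False
    then have "{a j..b j} \<subseteq> {a j}" by auto
    then have "measure (\<mu> j) {a j..b j} \<le> measure (\<mu> j) {a j}"
      by (intro \<mu>.finite_measure_mono) auto
    with null have "measure (\<mu> j) {a j..b j} = 0"
      by (simp add: measure_le_0_iff)
    moreover have "width j \<le> 0"
      using False \<mu>.cdf_nondecreasing[of "b j" "a j" j] by (simp add: width_def hi_def lo_def)
    ultimately show ?thesis by simp
  qed
qed

lemma prod_max_width: "lam \<le> (\<Prod>j<k. max 0 (width j))"
proof -
  have "lam \<le> prob {z \<in> space P. f (fst z) = 1}"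
    using target_heavy by (simp add: heavy_rectangles_def)
  also have "{z \<in> space P. f (fst z) = 1} = {z \<in> space P. \<forall>j<k. fst z j \<in> {a j..b j}}"
    by (auto simp: rectangle_eq_1_iff)
  also have "prob \<dots> = (\<Prod>j<k. max 0 (width j))"
    by (subst prob_coordinates) (simp_all add: measure_side)
  finally show ?thesis .
qed

text \<open>A degenerate side would make the mass of the target vanish, although it is at least
  \<open>lam > 0\<close>.\<close>

lemma width_pos:
  assumes "j < k"
  shows "0 < width j"
proof (rule ccontr)
  assume "\<not> 0 < width j"
  with assms have "(\<Prod>j<k. max 0 (width j)) = 0"
    by (intro prod_zero bexI[of _ j]) auto
  with prod_max_width lam_pos show False by simp
qed

lemma width_le_1: "width j \<le> 1"
  using lo_nonneg[of j] hi_le_1[of j] by (simp add: width_def)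

lemma prod_width: "lam \<le> (\<Prod>j<k. width j)"
proof -
  have "(\<Prod>j<k. max 0 (width j)) = (\<Prod>j<k. width j)"
    using width_pos by (intro prod.cong) (auto simp: max_def dest: less_imp_le)
  with prod_max_width show ?thesis by simp
qed

section \<open>Boxes, core and strips in uniform coordinates\<close>

definition "cdf_box c d = {z \<in> space P. \<forall>j<k. c j < U j (fst z j) \<and> U j (fst z j) < d j}"

lemma cdf_box_eq: "cdf_box c d = {z \<in> space P. \<forall>j<k. fst z j \<in> {y. c j < U j y \<and> U j y < d j}}"
  by (simp add: cdf_box_def)

lemma sets_cdf_box[measurable]: "cdf_box c d \<in> sets P"
  unfolding cdf_box_eq by (intro sets_coordinates) measurable

lemma prob_cdf_box:
  assumes "\<And>j. j < k \<Longrightarrow> 0 \<le> c j \<and> c j \<le> d j \<and> d j \<le> 1"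
  shows "prob (cdf_box c d) = (\<Prod>j<k. d j - c j)"
  unfolding cdf_box_eq using assms
  by (subst prob_coordinates)
    (auto intro!: prod.cong measure_cdf_oo real_distribution continuous_cdf)

text \<open>Small enough that cutting this fraction off both ends of every side costs at most half
  of the mass. It is also the coarsest scale, at which the bound \<open>4 * real k * \<rho>\<close>
  for the gap equals 1.\<close>

definition "margin = 1 / (4 * real k)"

lemma margin: "0 < margin" "margin \<le> 1 / 4" "margin \<le> 1"
  using k_pos by (auto simp: margin_def field_simps)

definition "core_lo j = lo j + margin * width j"
definition "core_hi j = hi j - margin * width j"

definition "in_hi \<rho> j = cdf_box (lo(j := hi j - \<rho> * width j)) hi"
definition "in_lo \<rho> j = cdf_box lo (hi(j := lo j + \<rho> * width j))"
definition "out_hi \<rho> j = cdf_box (core_lo(j := hi j)) (core_hi(j := hi j + \<rho>))"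
definition "out_lo \<rho> j = cdf_box (core_lo(j := lo j - \<rho>)) (core_hi(j := lo j))"

text \<open>
  Strips along the faces of the target, on either side. The outer ones lie over the core of the
  target only; where the target comes too close to the boundary of the unit cube, they are not needed.
\<close>

definition "strips \<rho> = in_hi \<rho> ` {..<k} \<union> in_lo \<rho> ` {..<k}
  \<union> out_hi \<rho> ` {j. j < k \<and> hi j + \<rho> \<le> 1} \<union> out_lo \<rho> ` {j. j < k \<and> 0 \<le> lo j - \<rho>}"

lemma finite_strips: "finite (strips \<rho>)"
  by (simp add: strips_def)

lemma card_strips: "card (strips \<rho>) \<le> 4 * k"
proof -
  have *: "card (g ` {j. j < k \<and> Q j}) \<le> k" for g :: "nat \<Rightarrow> ((nat \<Rightarrow> real) \<times> int) set" and Q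
  proof -
    have "card (g ` {j. j < k \<and> Q j}) \<le> card (g ` {..<k})"
      by (intro card_mono) auto
    also have "\<dots> \<le> k"
      using card_image_le[of "{..<k}" g] by simp
    finally show ?thesis .
  qed
  have in_card: "card (in_hi \<rho> ` {..<k}) \<le> k" "card (in_lo \<rho> ` {..<k}) \<le> k"
    using card_image_le[of "{..<k}"] by force+
  have un: "card (A \<union> B \<union> C \<union> D) \<le> card A + card B + card C + card D"
    for A B C D :: "((nat \<Rightarrow> real) \<times> int) set set"
    using card_Un_le[of "A \<union> B \<union> C" D] card_Un_le[of "A \<union> B" C] card_Un_le[of A B] by linarith
  show ?thesis
    unfolding strips_def
    by (rule order_trans[OF un])
      (use in_card *[of "out_hi \<rho>" "\<lambda>j. hi j + \<rho> \<le> 1"] *[of "out_lo \<rho>" "\<lambda>j. 0 \<le> lo j - \<rho>"]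
        in linarith)
qed

lemma sets_strips: "S \<in> strips \<rho> \<Longrightarrow> S \<in> sets P"
  by (auto simp: strips_def in_hi_def in_lo_def out_hi_def out_lo_def)

text \<open>Bernoulli's inequality gives \<open>(1 - 2 * margin) ^ k \<ge> 1 / 2\<close>; dropping
  the \<open>j\<close>-th factor, which is at most 1, does not decrease the product.\<close>

lemma prod_core: "lam / 2 \<le> (\<Prod>i\<in>{..<k} - {j}. core_hi i - core_lo i)" if "j < k"
proof -
  have core: "core_hi i - core_lo i = (1 - 2 * margin) * width i" for i
    by (simp add: core_hi_def core_lo_def width_def algebra_simps)
  have m: "0 \<le> 1 - 2 * margin" using margin by simp
  have "1 / 2 \<le> 1 + real k * (- (2 * margin))"
    using k_pos by (simp add: margin_def field_simps)
  also have "\<dots> \<le> (1 + - (2 * margin)) ^ k"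
    using margin by (intro Bernoulli_inequality) auto
  finally have B: "1 / 2 \<le> (1 - 2 * margin) ^ k" by simp
  have "lam / 2 = 1 / 2 * lam" by simp
  also have "\<dots> \<le> (1 - 2 * margin) ^ k * (\<Prod>i<k. width i)"
    using B prod_width lam_pos m by (intro mult_mono) auto
  also have "\<dots> = (\<Prod>i<k. core_hi i - core_lo i)"
    by (simp add: core prod.distrib)
  also have "\<dots> = (core_hi j - core_lo j) * (\<Prod>i\<in>{..<k} - {j}. core_hi i - core_lo i)"
    using that by (rule prod_fun_upd_split) simp
  also have "\<dots> \<le> 1 * (\<Prod>i\<in>{..<k} - {j}. core_hi i - core_lo i)"
  proof (rule mult_right_mono)
    show "core_hi j - core_lo j \<le> 1"
      unfolding core using margin width_le_1[of j] width_pos[OF that] by (intro mult_le_one) auto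
    show "0 \<le> (\<Prod>i\<in>{..<k} - {j}. core_hi i - core_lo i)"
      unfolding core using m width_pos by (intro prod_nonneg mult_nonneg_nonneg) (auto intro: less_imp_le)
  qed
  finally show ?thesis by simp
qed

lemma core_bounds:
  assumes "j < k"
  shows "0 \<le> core_lo j" "core_lo j \<le> core_hi j" "core_hi j \<le> 1"
proof -
  have "0 < margin * width j" "margin * width j \<le> 1 / 4 * width j"
    using margin width_pos[OF assms] by (auto intro!: mult_right_mono)
  then show "0 \<le> core_lo j" "core_lo j \<le> core_hi j" "core_hi j \<le> 1"
    using lo_nonneg[of j] hi_le_1[of j] width_pos[OF assms] width_def[of j]
    unfolding core_lo_def core_hi_def by linarith+
qed

text \<open>An inner strip is a fraction \<open>\<rho>\<close> of the target. An outer one has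
  length \<open>\<rho>\<close> over the core, which costs the factor 1/2; the side conditions in
  \<open>strips\<close> keep it inside the unit cube.\<close>

lemma prob_strips:
  assumes S: "S \<in> strips \<rho>" and \<rho>: "0 < \<rho>" "\<rho> \<le> 1"
  shows "\<rho> * lam / 2 \<le> prob S"
proof -
  have lohi: "lo j \<le> hi j" if "j < k" for j
    using width_pos[OF that] by (simp add: width_def)
  have rw: "0 \<le> \<rho> * width j" "\<rho> * width j \<le> width j" if "j < k" for j
    using \<rho> width_pos[OF that] by (auto simp: mult_le_cancel_right1)
  have inside: "\<rho> * lam / 2 \<le> \<rho> * width j * (\<Prod>i\<in>{..<k} - {j}. width i)" if "j < k" for j
  proof -
    have "\<rho> * lam / 2 \<le> \<rho> * lam" using \<rho> lam_pos by simp
    also have "\<dots> \<le> \<rho> * (\<Prod>i<k. width i)"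
      using \<rho> prod_width by (intro mult_left_mono) auto
    also have "(\<Prod>i<k. width i) = width j * (\<Prod>i\<in>{..<k} - {j}. width i)"
      using that by (rule prod_fun_upd_split) simp
    finally show ?thesis by (simp add: mult.assoc)
  qed
  have outside: "\<rho> * lam / 2 \<le> \<rho> * (\<Prod>i\<in>{..<k} - {j}. core_hi i - core_lo i)" if "j < k" for j
    using mult_left_mono[OF prod_core[OF that], of \<rho>] \<rho> by simp
  consider j where "j < k" "S = in_hi \<rho> j" | j where "j < k" "S = in_lo \<rho> j"
    | j where "j < k" "hi j + \<rho> \<le> 1" "S = out_hi \<rho> j" | j where "j < k" "0 \<le> lo j - \<rho>" "S = out_lo \<rho> j"
    using S unfolding strips_def by blast
  then show ?thesis
  proof cases
    case (1 j)
    have "prob S = (\<Prod>i<k. hi i - (lo(j := hi j - \<rho> * width j)) i)"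
      unfolding 1 in_hi_def using lo_nonneg hi_le_1 lohi rw[OF 1(1)]
      by (intro prob_cdf_box) (fastforce simp: width_def)
    also have "\<dots> = \<rho> * width j * (\<Prod>i\<in>{..<k} - {j}. width i)"
      using 1(1) by (subst prod_fun_upd_split[where j=j and g=width]) (auto simp: width_def)
    finally show ?thesis using inside[OF 1(1)] by simp
  next
    case (2 j)
    have "prob S = (\<Prod>i<k. (hi(j := lo j + \<rho> * width j)) i - lo i)"
      unfolding 2 in_lo_def using lo_nonneg hi_le_1 lohi rw[OF 2(1)] hi_le_1[of j]
      by (intro prob_cdf_box) (auto simp: width_def, smt (verit))
    also have "\<dots> = \<rho> * width j * (\<Prod>i\<in>{..<k} - {j}. width i)"
      using 2(1) by (subst prod_fun_upd_split[where j=j and g=width]) (auto simp: width_def)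
    finally show ?thesis using inside[OF 2(1)] by simp
  next
    case (3 j)
    have "prob S = (\<Prod>i<k. (core_hi(j := hi j + \<rho>)) i - (core_lo(j := hi j)) i)"
      unfolding 3 out_hi_def using core_bounds 3 \<rho> lo_nonneg[of j] lohi[OF 3(1)]
      by (intro prob_cdf_box) auto
    also have "\<dots> = \<rho> * (\<Prod>i\<in>{..<k} - {j}. core_hi i - core_lo i)"
      using 3(1) by (subst prod_fun_upd_split[where j=j and g="\<lambda>i. core_hi i - core_lo i"]) auto
    finally show ?thesis using outside[OF 3(1)] by simp
  next
    case (4 j)
    have "prob S = (\<Prod>i<k. (core_hi(j := lo j)) i - (core_lo(j := lo j - \<rho>)) i)"
      unfolding 4 out_lo_def using core_bounds 4 \<rho> hi_le_1[of j] lohi[OF 4(1)]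
      by (intro prob_cdf_box) auto
    also have "\<dots> = \<rho> * (\<Prod>i\<in>{..<k} - {j}. core_hi i - core_lo i)"
      using 4(1) by (subst prod_fun_upd_split[where j=j and g="\<lambda>i. core_hi i - core_lo i"]) auto
    finally show ?thesis using outside[OF 4(1)] by simp
  qed
qed

section \<open>What a sample that hits all strips tells about consistent rectangles\<close>

definition hits :: "(nat \<Rightarrow> (nat \<Rightarrow> real) \<times> int) \<Rightarrow> nat \<Rightarrow> real \<Rightarrow> bool"
  where "hits \<omega> T \<rho> \<longleftrightarrow> (\<forall>S\<in>strips \<rho>. \<exists>s<T. \<omega> s \<in> S)"

lemma hitsE:
  assumes "hits \<omega> T \<rho>" "S \<in> strips \<rho>"
  obtains s where "s < T" "\<omega> s \<in> S"
  using assms by (auto simp: hits_def)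

text \<open>The inner box shrinks in proportion to the widths and the outer one grows by an absolute
  amount, matching the thickness of the inner and outer strips.\<close>

definition "inner_box \<rho> = {x. \<forall>j<k. lo j + \<rho> * width j \<le> U j (x j) \<and> U j (x j) \<le> hi j - \<rho> * width j}"
definition "outer_box \<rho> = {x. \<forall>j<k. lo j - \<rho> \<le> U j (x j) \<and> U j (x j) \<le> hi j + \<rho>}"

text \<open>Strict inequalities between CDF values lift to the original coordinates, even where the
  CDF has flat pieces. This is why the boxes of type \<open>cdf_box\<close> are open.\<close>

lemma target_label:
  assumes "\<And>i. i < k \<Longrightarrow> lo i < U i (x i) \<and> U i (x i) < hi i"
  shows "f x = 1"
proof -
  have "a i \<le> x i \<and> x i \<le> b i" if "i < k" for i
    using assms[OF that] U_less_imp[of i "a i" "x i"] U_less_imp[of i "x i" "b i"]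
    by (simp add: lo_def hi_def less_imp_le)
  then show ?thesis by (simp add: rectangle_eq_1_iff)
qed

context
  fixes \<omega> :: "nat \<Rightarrow> (nat \<Rightarrow> real) \<times> int" and T :: nat and \<alpha> \<beta> :: "nat \<Rightarrow> real"
  assumes true_labels: "\<And>s. snd (\<omega> s) = f (fst (\<omega> s))"
    and consistent: "\<And>s. s < T \<Longrightarrow> rectangle k \<alpha> \<beta> (fst (\<omega> s)) = snd (\<omega> s)"
begin

text \<open>Since \<open>\<rho> \<le> 1\<close>, the inner strip stays within the target. A sample
  in it is therefore positive and belongs to every consistent rectangle; \<open>y\<close> is its
  \<open>j\<close>-th coordinate.\<close>

lemma positive_hi:
  assumes "hits \<omega> T \<rho>" "0 < \<rho>" "\<rho> \<le> 1" "j < k"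
  obtains y where "hi j - \<rho> * width j < U j y" "U j y < hi j" "\<alpha> j \<le> y" "y \<le> \<beta> j"
proof -
  have "in_hi \<rho> j \<in> strips \<rho>" using assms(4) by (simp add: strips_def)
  with assms(1) obtain s where s: "s < T" "\<omega> s \<in> in_hi \<rho> j" by (rule hitsE)
  have *: "(if i = j then hi j - \<rho> * width j else lo i) < U i (fst (\<omega> s) i)"
    "U i (fst (\<omega> s) i) < hi i" if "i < k" for i
    using s(2) that by (auto simp: in_hi_def cdf_box_def)
  have "\<rho> * width j \<le> width j"
    using assms width_pos by (simp add: mult_le_cancel_right1)
  then have le: "lo j \<le> hi j - \<rho> * width j" by (simp add: width_def)
  have "lo i < U i (fst (\<omega> s) i) \<and> U i (fst (\<omega> s) i) < hi i" if "i < k" for i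
    using *[OF that] le by (auto split: if_splits)
  then have "f (fst (\<omega> s)) = 1"
    by (rule target_label)
  then have "rectangle k \<alpha> \<beta> (fst (\<omega> s)) = 1"
    using consistent[OF s(1)] true_labels[of s] by simp
  then have "\<forall>i<k. \<alpha> i \<le> fst (\<omega> s) i \<and> fst (\<omega> s) i \<le> \<beta> i"
    by (simp only: rectangle_eq_1_iff)
  with *[OF assms(4)] assms(4) that[of "fst (\<omega> s) j"] show thesis by simp
qed

lemma positive_lo:
  assumes "hits \<omega> T \<rho>" "0 < \<rho>" "\<rho> \<le> 1" "j < k"
  obtains y where "lo j < U j y" "U j y < lo j + \<rho> * width j" "\<alpha> j \<le> y" "y \<le> \<beta> j"
proof -
  have "in_lo \<rho> j \<in> strips \<rho>" using assms(4) by (simp add: strips_def)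
  with assms(1) obtain s where s: "s < T" "\<omega> s \<in> in_lo \<rho> j" by (rule hitsE)
  have *: "lo i < U i (fst (\<omega> s) i)"
    "U i (fst (\<omega> s) i) < (if i = j then lo j + \<rho> * width j else hi i)" if "i < k" for i
    using s(2) that by (auto simp: in_lo_def cdf_box_def)
  have "\<rho> * width j \<le> width j"
    using assms width_pos by (simp add: mult_le_cancel_right1)
  then have le: "lo j + \<rho> * width j \<le> hi j" by (simp add: width_def)
  have "lo i < U i (fst (\<omega> s) i) \<and> U i (fst (\<omega> s) i) < hi i" if "i < k" for i
    using *[OF that] le by (auto split: if_splits)
  then have "f (fst (\<omega> s)) = 1"
    by (rule target_label)
  then have "rectangle k \<alpha> \<beta> (fst (\<omega> s)) = 1"
    using consistent[OF s(1)] true_labels[of s] by simp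
  then have "\<forall>i<k. \<alpha> i \<le> fst (\<omega> s) i \<and> fst (\<omega> s) i \<le> \<beta> i"
    by (simp only: rectangle_eq_1_iff)
  with *[OF assms(4)] assms(4) that[of "fst (\<omega> s) j"] show thesis by simp
qed

text \<open>The point \<open>y\<close> lies between two positive witnesses near opposite faces, and
  sides are intervals.\<close>

lemma inner_side:
  assumes "hits \<omega> T \<rho>" "0 < \<rho>" "\<rho> \<le> 1" "j < k"
    and "lo j + \<rho> * width j \<le> U j y" "U j y \<le> hi j - \<rho> * width j"
  shows "\<alpha> j \<le> y" "y \<le> \<beta> j"
proof -
  obtain y' where "U j y' < lo j + \<rho> * width j" "\<alpha> j \<le> y'"
    using assms(1-4) by (rule positive_lo)
  with assms(5) U_less_imp[of j y' y] show "\<alpha> j \<le> y" by linarith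
  obtain y' where "hi j - \<rho> * width j < U j y'" "y' \<le> \<beta> j"
    using assms(1-4) by (rule positive_hi)
  with assms(6) U_less_imp[of j y y'] show "y \<le> \<beta> j" by linarith
qed

text \<open>
  Over the core all sides but the \<open>j\<close>-th contain the point, so a negative point there bounds the
  \<open>j\<close>-th side.
\<close>

lemma negative_side:
  assumes core: "hits \<omega> T margin" and j: "j < k" and s: "s < T"
    and others: "\<And>i. i < k \<Longrightarrow> i \<noteq> j \<Longrightarrow>
      core_lo i < U i (fst (\<omega> s) i) \<and> U i (fst (\<omega> s) i) < core_hi i"
    and neg: "f (fst (\<omega> s)) \<noteq> 1"
  shows "\<not> (\<alpha> j \<le> fst (\<omega> s) j \<and> fst (\<omega> s) j \<le> \<beta> j)"
proof
  assume in_j: "\<alpha> j \<le> fst (\<omega> s) j \<and> fst (\<omega> s) j \<le> \<beta> j"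
  have "\<alpha> i \<le> fst (\<omega> s) i \<and> fst (\<omega> s) i \<le> \<beta> i" if "i < k" for i
  proof (cases "i = j")
    case False
    with others[OF that] show ?thesis
      using inner_side[OF core margin(1,3) that, of "fst (\<omega> s) i"]
      by (simp add: core_lo_def core_hi_def)
  qed (use in_j in simp)
  then have "rectangle k \<alpha> \<beta> (fst (\<omega> s)) = 1" by (simp add: rectangle_eq_1_iff)
  with neg consistent[OF s] true_labels show False by simp
qed

text \<open>A negative sample just above the face, over the core, falls outside the
  \<open>j\<close>-th side of the consistent rectangle. When the strip would leave the unit cube,
  the claim follows from CDF values being at most 1.\<close>

lemma outer_hi:
  assumes core: "hits \<omega> T margin" and hits: "hits \<omega> T \<rho>" and \<rho>: "0 < \<rho>" and j: "j < k"
    and y: "y \<le> \<beta> j"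
  shows "U j y \<le> hi j + \<rho>"
proof (cases "hi j + \<rho> \<le> 1")
  case False
  then show ?thesis using \<mu>.cdf_bounded_prob[of j y] by simp
next
  case True
  with j have "out_hi \<rho> j \<in> strips \<rho>" by (simp add: strips_def)
  with hits obtain s where s: "s < T" "\<omega> s \<in> out_hi \<rho> j" by (rule hitsE)
  let ?x = "fst (\<omega> s)"
  have others: "core_lo i < U i (?x i) \<and> U i (?x i) < core_hi i" if "i < k" "i \<noteq> j" for i
    using s(2) that by (auto simp: out_hi_def cdf_box_def)
  have x: "hi j < U j (?x j)" "U j (?x j) < hi j + \<rho>"
    using s(2) j by (auto simp: out_hi_def cdf_box_def split: if_splits)
  have "b j < ?x j" using x(1) by (simp add: hi_def U_less_imp)
  then have neg: "f ?x \<noteq> 1" using j by (auto simp: rectangle_eq_1_iff not_le)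
  have out: "\<not> (\<alpha> j \<le> ?x j \<and> ?x j \<le> \<beta> j)"
    using core j s(1) others neg by (rule negative_side)
  \<comment> \<open>A positive sample below the face excludes that the negative one lies under
    \<open>\<alpha> j\<close>, so it lies above \<open>\<beta> j\<close>.\<close>
  obtain p where "U j p < hi j" "\<alpha> j \<le> p"
    by (rule positive_hi[OF core margin(1,3) j])
  then have "\<alpha> j \<le> ?x j" using x(1) U_less_imp[of j p "?x j"] by linarith
  with out have "y \<le> ?x j" using y by linarith
  then show ?thesis using \<mu>.cdf_nondecreasing[of y "?x j" j] x(2) by linarith
qed

lemma outer_lo:
  assumes core: "hits \<omega> T margin" and hits: "hits \<omega> T \<rho>" and \<rho>: "0 < \<rho>" and j: "j < k"
    and y: "\<alpha> j \<le> y"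
  shows "lo j - \<rho> \<le> U j y"
proof (cases "0 \<le> lo j - \<rho>")
  case False
  then show ?thesis using \<mu>.cdf_nonneg[of j y] by simp
next
  case True
  with j have "out_lo \<rho> j \<in> strips \<rho>" by (simp add: strips_def)
  with hits obtain s where s: "s < T" "\<omega> s \<in> out_lo \<rho> j" by (rule hitsE)
  let ?x = "fst (\<omega> s)"
  have others: "core_lo i < U i (?x i) \<and> U i (?x i) < core_hi i" if "i < k" "i \<noteq> j" for i
    using s(2) that by (auto simp: out_lo_def cdf_box_def)
  have x: "lo j - \<rho> < U j (?x j)" "U j (?x j) < lo j"
    using s(2) j by (auto simp: out_lo_def cdf_box_def split: if_splits)
  have "?x j < a j" using x(2) by (simp add: lo_def U_less_imp)
  then have neg: "f ?x \<noteq> 1" using j by (auto simp: rectangle_eq_1_iff not_le)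
  have out: "\<not> (\<alpha> j \<le> ?x j \<and> ?x j \<le> \<beta> j)"
    using core j s(1) others neg by (rule negative_side)
  obtain p where "lo j < U j p" "p \<le> \<beta> j"
    by (rule positive_lo[OF core margin(1,3) j])
  then have "?x j \<le> \<beta> j" using x(2) U_less_imp[of j "?x j" p] by linarith
  with out have "?x j \<le> y" using y by linarith
  then show ?thesis using \<mu>.cdf_nondecreasing[of "?x j" y j] x(1) by linarith
qed

text \<open>Two scales enter: hits at scale \<open>margin\<close> place the core inside every
  consistent rectangle, hits at scale \<open>\<rho>\<close> give the precision.\<close>

lemma sandwich:
  assumes "hits \<omega> T margin" "hits \<omega> T \<rho>" "0 < \<rho>" "\<rho> \<le> 1"
  shows "x \<in> inner_box \<rho> \<Longrightarrow> rectangle k \<alpha> \<beta> x = 1"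
    and "rectangle k \<alpha> \<beta> x = 1 \<Longrightarrow> x \<in> outer_box \<rho>"
  using inner_side[OF assms(2-4)] outer_lo[OF assms(1-3)] outer_hi[OF assms(1-3)]
  by (auto simp: inner_box_def outer_box_def rectangle_eq_1_iff)

end

section \<open>Queries and error of a typical sample\<close>

definition "gap \<rho> = {z \<in> space P. fst z \<in> outer_box \<rho> \<and> fst z \<notin> inner_box \<rho>}"

lemma sets_gap[measurable]: "gap \<rho> \<in> sets P"
proof -
  have [measurable]: "{z \<in> space P. \<forall>j<k. fst z j \<in> {y. lo j - \<rho> \<le> U j y \<and> U j y \<le> hi j + \<rho>}} \<in> sets P"
    "{z \<in> space P. \<forall>j<k. fst z j \<in> {y. lo j + \<rho> * width j \<le> U j y \<and> U j y \<le> hi j - \<rho> * width j}} \<in> sets P"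
    by (intro sets_coordinates; measurable)+
  have "gap \<rho> = {z \<in> space P. \<forall>j<k. fst z j \<in> {y. lo j - \<rho> \<le> U j y \<and> U j y \<le> hi j + \<rho>}}
    - {z \<in> space P. \<forall>j<k. fst z j \<in> {y. lo j + \<rho> * width j \<le> U j y \<and> U j y \<le> hi j - \<rho> * width j}}"
    by (auto simp: gap_def outer_box_def inner_box_def)
  also have "\<dots> \<in> sets P" by measurable
  finally show ?thesis .
qed

text \<open>The gap is covered by two slabs per coordinate, one around each face, reaching
  \<open>\<rho>\<close> outwards and \<open>\<rho> * width j \<le> \<rho>\<close> inwards.\<close>

lemma prob_gap:
  assumes \<rho>: "0 < \<rho>"
  shows "prob (gap \<rho>) \<le> 4 * real k * \<rho>"
proof -
  define A where "A j = {z \<in> space P. fst z j \<in> {y. lo j - \<rho> \<le> U j y \<and> U j y \<le> lo j + \<rho> * width j}}" for j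
  define B where "B j = {z \<in> space P. fst z j \<in> {y. hi j - \<rho> * width j \<le> U j y \<and> U j y \<le> hi j + \<rho>}}" for j
  have [measurable]: "A j \<in> sets P" "B j \<in> sets P" if "j \<in> {..<k}" for j
    using that unfolding A_def B_def by measurable
  have AB: "prob (A j) \<le> 2 * \<rho>" "prob (B j) \<le> 2 * \<rho>" if j: "j < k" for j
  proof -
    have w: "0 < \<rho> * width j" "\<rho> * width j \<le> \<rho>"
      using \<rho> width_pos[OF j] width_le_1[of j] by (auto simp: mult_le_cancel_left1)
    have lh: "0 \<le> lo j" "lo j \<le> 1" "0 \<le> hi j" "hi j \<le> 1"
      using lo_nonneg[of j] hi_le_1[of j] width_pos[OF j] width_def[of j] by linarith+
    have "prob (A j) \<le> lo j + \<rho> * width j - (lo j - \<rho>)"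
      unfolding A_def using w lh \<rho>
      by (subst prob_coordinate[OF j], measurable)
        (intro measure_cdf_cc_le real_distribution continuous_cdf; linarith)
    then show "prob (A j) \<le> 2 * \<rho>" using w by linarith
    have "prob (B j) \<le> hi j + \<rho> - (hi j - \<rho> * width j)"
      unfolding B_def using w lh \<rho>
      by (subst prob_coordinate[OF j], measurable)
        (intro measure_cdf_cc_le real_distribution continuous_cdf; linarith)
    then show "prob (B j) \<le> 2 * \<rho>" using w by linarith
  qed
  have "gap \<rho> \<subseteq> (\<Union>j\<in>{..<k}. A j \<union> B j)"
  proof
    fix z assume z: "z \<in> gap \<rho>"
    then obtain j where j: "j < k"
      "\<not> (lo j + \<rho> * width j \<le> U j (fst z j) \<and> U j (fst z j) \<le> hi j - \<rho> * width j)"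
      unfolding gap_def inner_box_def by blast
    moreover have "lo j - \<rho> \<le> U j (fst z j)" "U j (fst z j) \<le> hi j + \<rho>" "z \<in> space P"
      using z j(1) by (auto simp: gap_def outer_box_def)
    ultimately have "z \<in> A j \<union> B j" by (auto simp: A_def B_def)
    with j(1) show "z \<in> (\<Union>j\<in>{..<k}. A j \<union> B j)" by blast
  qed
  then have "prob (gap \<rho>) \<le> prob (\<Union>j\<in>{..<k}. A j \<union> B j)"
    by (intro finite_measure_mono) auto
  also have "\<dots> \<le> (\<Sum>j\<in>{..<k}. prob (A j \<union> B j))"
    by (intro finite_measure_subadditive_finite) auto
  also have "\<dots> \<le> (\<Sum>j\<in>{..<k}. 4 * \<rho>)"
  proof (rule sum_mono)
    fix j assume "j \<in> {..<k}"
    then have "prob (A j \<union> B j) \<le> prob (A j) + prob (B j)"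
      by (intro measure_Un_le) auto
    then show "prob (A j \<union> B j) \<le> 4 * \<rho>"
      using AB[of j] \<open>j \<in> {..<k}\<close> by simp
  qed
  finally show ?thesis by (simp add: mult.commute mult.left_commute)
qed

lemma hits_mono: "hits \<omega> T \<rho> \<Longrightarrow> T \<le> T' \<Longrightarrow> hits \<omega> T' \<rho>"
  unfolding hits_def by (meson order_less_le_trans)

text \<open>Of two classifiers that disagree at \<open>x\<close>, one accepts it, so
  \<open>x\<close> is in the outer box, and the other rejects it, so \<open>x\<close> is not in the
  inner box.\<close>

lemma VS_disagreement:
  assumes labels: "\<And>s. snd (\<omega> s) = f (fst (\<omega> s))"
    and hits: "hits \<omega> T margin" "hits \<omega> T \<rho>" "0 < \<rho>" "\<rho> \<le> 1"
    and hg: "h \<in> VS F (sample \<omega> (enat T))" "g \<in> VS F (sample \<omega> (enat T))" "h x \<noteq> g x"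
  shows "x \<in> outer_box \<rho>" "x \<notin> inner_box \<rho>"
proof -
  obtain \<alpha> \<beta> \<alpha>' \<beta>' where rect: "h = rectangle k \<alpha> \<beta>" "g = rectangle k \<alpha>' \<beta>'"
    using hg(1,2) by (auto simp: VS_def elim!: heavy_rectangleE)
  have cons: "h (fst (\<omega> s)) = snd (\<omega> s)" "g (fst (\<omega> s)) = snd (\<omega> s)" if "s < T" for s
    using hg(1,2) that by (auto simp: in_VS_sample_iff)
  note h = sandwich[OF labels cons(1)[unfolded rect] hits, folded rect]
  note g = sandwich[OF labels cons(2)[unfolded rect] hits, folded rect]
  from hg(3) have "h x = 1 \<or> g x = 1" by (auto simp: rect rectangle_eq_if split: if_splits)
  then show "x \<in> outer_box \<rho>" using h(2) g(2) by blast
  show "x \<notin> inner_box \<rho>"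
  proof
    assume "x \<in> inner_box \<rho>"
    with h(1) g(1) hg(3) show False by simp
  qed
qed

section \<open>Dyadic scales and typical samples\<close>

definition "level i = margin / 2 ^ i"

lemma level: "0 < level i" "level i \<le> 1" "level 0 = margin"
proof -
  have "margin \<le> 1 * 2 ^ i"
    using margin(3) one_le_power[of "2::real" i] by linarith
  then show "level i \<le> 1" by (simp add: level_def divide_le_eq)
qed (use margin in \<open>auto simp: level_def\<close>)

lemma prob_gap_level: "prob (gap (level i)) \<le> 1 / 2 ^ i"
  using prob_gap[OF level(1), of i] k_pos by (simp add: level_def margin_def)

text \<open>Doubling the sample while halving the thickness keeps their product fixed, so every
  scale has the same failure bound.\<close>

definition "typical T L \<omega> \<longleftrightarrow>
  (\<forall>s. snd (\<omega> s) = f (fst (\<omega> s))) \<and> (\<forall>i\<le>L. hits \<omega> (2 ^ i * T) (level i))"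

text \<open>Deterministic supersets of the disagreement regions of a typical sample.\<close>

definition "query_region T L s = {z \<in> space P. \<forall>i\<le>L. 2 ^ i * T \<le> s \<longrightarrow> z \<in> gap (level i)}"

lemma sets_query_region[measurable]: "query_region T L s \<in> sets P"
  unfolding query_region_def by measurable

text \<open>The scale \<open>margin\<close> is level 0, reached at time \<open>T\<close>; its hits
  persist at all later times.\<close>

lemma typicalD:
  assumes "typical T L \<omega>" "i \<le> L"
  shows "snd (\<omega> s) = f (fst (\<omega> s))" "hits \<omega> (2 ^ i * T) margin" "hits \<omega> (2 ^ i * T) (level i)"
proof -
  have "hits \<omega> T margin" using assms level(3) by (auto simp: typical_def dest: spec[of _ 0])
  then show "hits \<omega> (2 ^ i * T) margin" by (rule hits_mono) simp
qed (use assms in \<open>auto simp: typical_def\<close>)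

text \<open>At time \<open>s\<close> the version space is contained in those of all dyadic times up
  to \<open>s\<close>, so a disagreement point lies in all their gaps.\<close>

lemma typical_query:
  assumes typical: "typical T L \<omega>" and \<omega>: "\<omega> \<in> space iid"
    and x: "fst (\<omega> s) \<in> DIS X (VS F (sample \<omega> (enat s)))"
  shows "\<omega> s \<in> query_region T L s"
proof -
  obtain h g where hg: "h \<in> VS F (sample \<omega> (enat s))" "g \<in> VS F (sample \<omega> (enat s))"
    "h (fst (\<omega> s)) \<noteq> g (fst (\<omega> s))"
    using x by (auto simp: DIS_def)
  have "\<omega> s \<in> gap (level i)" if i: "i \<le> L" "2 ^ i * T \<le> s" for i
  proof -
    have "VS F (sample \<omega> (enat s)) \<subseteq> VS F (sample \<omega> (enat (2 ^ i * T)))"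
      using i(2) by (intro VS_sample_antimono) simp
    with hg(1,2) have "h \<in> VS F (sample \<omega> (enat (2 ^ i * T)))" "g \<in> VS F (sample \<omega> (enat (2 ^ i * T)))"
      by (auto dest: subsetD)
    from VS_disagreement[OF typicalD(1)[OF typical i(1)] typicalD(2,3)[OF typical i(1)] level(1,2) this hg(3)]
    show ?thesis using \<omega> by (auto simp: gap_def space_PiM)
  qed
  with \<omega> show ?thesis by (auto simp: query_region_def space_PiM)
qed

lemma typical_num_queries:
  assumes "typical T L \<omega>" and "\<omega> \<in> space iid"
  shows "real (num_queries X F \<omega> m) \<le> (\<Sum>s<m. indicator (query_region T L s) (\<omega> s))"
  unfolding num_queries_eq of_nat_sum
  by (rule sum_mono) (use typical_query[OF assms] in \<open>auto simp: indicator_def\<close>)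

text \<open>The target itself is in the version space, so almost every error of \<open>h\<close> is
  a disagreement with it.\<close>

lemma typical_error:
  assumes typical: "typical T L \<omega>"
  shows "VS_error_le F P (1 / 2 ^ L) \<omega> (enat (2 ^ L * T))"
  unfolding VS_error_le_def
proof
  fix h assume h: "h \<in> VS F (sample \<omega> (enat (2 ^ L * T)))"
  have fV: "f \<in> VS F (sample \<omega> (enat (2 ^ L * T)))"
    using typicalD(1)[OF typical order_refl] target_heavy by (simp add: in_VS_sample_iff)
  have "er P h \<le> prob (gap (level L))"
    unfolding er_def
  proof (rule finite_measure_mono_AE)
    show "AE z in P. z \<in> {z \<in> space P. h (fst z) \<noteq> snd z} \<longrightarrow> z \<in> gap (level L)"
      using labels
    proof eventually_elim
      case (elim z)
      show ?case
      proof
        assume "z \<in> {z \<in> space P. h (fst z) \<noteq> snd z}"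
        then have z: "z \<in> space P" "h (fst z) \<noteq> f (fst z)" using elim by auto
        from VS_disagreement[OF typicalD(1)[OF typical order_refl] typicalD(2,3)[OF typical order_refl] level(1,2) h fV z(2)]
        show "z \<in> gap (level L)" using z(1) by (simp add: gap_def)
      qed
    qed
  qed simp
  with prob_gap_level show "er P h \<le> 1 / 2 ^ L" by (rule order_trans[rotated])
qed

text \<open>The first \<open>T\<close> terms contribute at most \<open>T\<close>. Each later dyadic
  block has \<open>2 ^ l * T\<close> terms of size at most \<open>1 / 2 ^ l\<close>, hence again
  contributes at most \<open>T\<close>.\<close>

lemma sum_prob_query_region:
  assumes "l \<le> L"
  shows "(\<Sum>s<2 ^ l * T. prob (query_region T L s)) \<le> real T * (real l + 1)"
  using assms
proof (induction l)
  case 0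
  have "(\<Sum>s<T. prob (query_region T L s)) \<le> (\<Sum>s<T. 1)"
    by (rule sum_mono) simp
  then show ?case by simp
next
  case (Suc l)
  have "(\<Sum>s<2 ^ Suc l * T. prob (query_region T L s))
      = (\<Sum>s<2 ^ l * T. prob (query_region T L s)) + (\<Sum>s=2 ^ l * T..<2 ^ Suc l * T. prob (query_region T L s))"
    by (simp add: atLeast0LessThan[symmetric] sum.atLeastLessThan_concat)
  also have "(\<Sum>s=2 ^ l * T..<2 ^ Suc l * T. prob (query_region T L s)) \<le> (\<Sum>s=2 ^ l * T..<2 ^ Suc l * T. 1 / 2 ^ l)"
  proof (rule sum_mono)
    fix s assume s: "s \<in> {2 ^ l * T..<2 ^ Suc l * T}"
    have "query_region T L s \<subseteq> gap (level l)"
      using s Suc.prems by (auto simp: query_region_def)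
    then have "prob (query_region T L s) \<le> prob (gap (level l))"
      by (rule finite_measure_mono) simp
    then show "prob (query_region T L s) \<le> 1 / 2 ^ l" using prob_gap_level[of l] by simp
  qed
  also have "\<dots> = real T"
    by (simp add: of_nat_diff)
  finally show ?case using Suc by (simp add: algebra_simps)
qed

text \<open>The first failure term is a union bound over \<open>L + 1\<close> scales with at most
  \<open>4 * k\<close> strips each, the second the Chernoff bound for the dominating count.\<close>

lemma prob_success:
  "measure iid {\<omega> \<in> space iid. VS_error_le F P (1 / 2 ^ L) \<omega> (enat (2 ^ L * T))
      \<and> real (num_queries X F \<omega> (2 ^ L * T)) < y}
    \<ge> 1 - ((real L + 1) * (4 * real k) * exp (- (lam * real T / (8 * real k)))
      + exp (2 * real T * (real L + 1) - y))"
    (is "measure iid ?E \<ge> 1 - (?p + ?q)")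
proof -
  interpret I: prob_space iid by (rule prob_space_iid)
  define miss where "miss i S = {\<omega> \<in> space iid. \<forall>s<2 ^ i * T. \<omega> s \<notin> S}" for i S
  define many where "many = {\<omega> \<in> space iid. y \<le> (\<Sum>s<2 ^ L * T. indicator (query_region T L s) (\<omega> s) :: real)}"
  have miss_sets: "miss i S \<in> sets iid" if "S \<in> strips (level i)" for i S
  proof -
    have [measurable]: "S \<in> sets P" using that by (rule sets_strips)
    show ?thesis unfolding miss_def by measurable
  qed
  have many_sets[measurable]: "many \<in> sets iid" unfolding many_def by measurable
  have E[measurable]: "?E \<in> sets iid" by measurable
  let ?miss = "\<lambda>i. \<Union>S\<in>strips (level i). miss i S"
  have Mi: "?miss i \<in> sets iid" for i
    using miss_sets finite_strips by (intro sets.finite_UN) auto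
  have M: "(\<Union>i\<le>L. ?miss i) \<in> sets iid"
    by (rule sets.finite_UN[OF _ Mi]) simp
  have prob_miss: "I.prob (miss i S) \<le> exp (- (lam * real T / (8 * real k)))"
    if "S \<in> strips (level i)" for i S
  proof -
    have "I.prob (miss i S) \<le> exp (- (level i * lam / 2 * real (2 ^ i * T)))"
      unfolding miss_def by (intro prob_iid_miss_le sets_strips[OF that] prob_strips that level)
    \<comment> \<open>The powers of 2 cancel, so the bound does not depend on the scale.\<close>
    also have "level i * lam / 2 * real (2 ^ i * T) = lam * real T / (8 * real k)"
      by (simp add: level_def margin_def)
    finally show ?thesis .
  qed
  have "I.prob (?miss i) \<le> (4 * real k) * exp (- (lam * real T / (8 * real k)))" for i
  proof -
    have "I.prob (?miss i) \<le> (\<Sum>S\<in>strips (level i). I.prob (miss i S))"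
      using miss_sets finite_strips by (intro I.finite_measure_subadditive_finite) auto
    also have "\<dots> \<le> (\<Sum>S\<in>strips (level i). exp (- (lam * real T / (8 * real k))))"
      by (intro sum_mono prob_miss)
    also have "\<dots> \<le> (4 * real k) * exp (- (lam * real T / (8 * real k)))"
      using of_nat_mono[OF card_strips[of "level i"], where 'a=real]
      by (simp add: mult_right_mono)
    finally show ?thesis .
  qed
  then have "(\<Sum>i\<le>L. I.prob (?miss i)) \<le> (\<Sum>i\<le>L. (4 * real k) * exp (- (lam * real T / (8 * real k))))"
    by (intro sum_mono)
  moreover have "I.prob (\<Union>i\<le>L. ?miss i) \<le> (\<Sum>i\<le>L. I.prob (?miss i))"
    using Mi by (intro I.finite_measure_subadditive_finite) auto
  ultimately have p: "I.prob (\<Union>i\<le>L. ?miss i) \<le> ?p"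
    by (simp add: algebra_simps)
  have "I.prob many \<le> exp (2 * (\<Sum>s<2 ^ L * T. prob (query_region T L s)) - y)"
    unfolding many_def by (rule prob_iid_count_ge) simp
  also have "\<dots> \<le> ?q"
    using sum_prob_query_region[of L L T] by (simp add: mult.assoc)
  finally have q: "I.prob many \<le> ?q" .
  \<comment> \<open>Labels agree with the target only almost surely, so the failure event is covered
    up to a null set.\<close>
  have "I.prob (space iid - ?E) \<le> I.prob ((\<Union>i\<le>L. ?miss i) \<union> many)"
  proof (rule I.finite_measure_mono_AE)
    show "AE \<omega> in iid. \<omega> \<in> space iid - ?E \<longrightarrow> \<omega> \<in> (\<Union>i\<le>L. ?miss i) \<union> many"
      using AE_iid[OF labels] AE_space
    proof eventually_elim
      case (elim \<omega>)
      show ?case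
      proof (intro impI, rule ccontr)
        assume 1: "\<omega> \<in> space iid - ?E" and 2: "\<omega> \<notin> (\<Union>i\<le>L. ?miss i) \<union> many"
        have "hits \<omega> (2 ^ i * T) (level i)" if "i \<le> L" for i
          using 2 that elim(2) by (auto simp: hits_def miss_def)
        with elim(1) have typical: "typical T L \<omega>" by (simp add: typical_def)
        from typical_num_queries[OF this elim(2), of "2 ^ L * T"] 2 elim(2)
        have "real (num_queries X F \<omega> (2 ^ L * T)) < y" by (auto simp: many_def)
        with typical_error[OF typical] 1 show False by simp
      qed
    qed
  qed (use M in simp)
  also have "\<dots> \<le> I.prob (\<Union>i\<le>L. ?miss i) + I.prob many"
    using M by (intro measure_Un_le) auto
  finally have "1 - I.prob ?E \<le> ?p + ?q"
    using p q by (simp add: I.prob_compl)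
  then show ?thesis by simp
qed

text \<open>The bound on \<open>T\<close> makes missed strips cost at most
  \<open>\<delta> / 2\<close>, and the bound on \<open>y\<close> does the same for excess
  queries.\<close>

lemma prob_success_ge:
  assumes \<delta>: "0 < \<delta>"
    and T: "8 * real k / lam * ln (8 * real k * (real L + 1) / \<delta>) \<le> real T"
    and y: "2 * real T * (real L + 1) + ln (2 / \<delta>) \<le> y"
  shows "measure iid {\<omega> \<in> space iid. VS_error_le F P (1 / 2 ^ L) \<omega> (enat (2 ^ L * T))
      \<and> real (num_queries X F \<omega> (2 ^ L * T)) < y} \<ge> 1 - \<delta>"
proof -
  have k: "0 < real k" using k_pos by simp
  let ?r = "8 * real k * (real L + 1) / \<delta>"
  have r: "0 < ?r" using k \<delta> by (simp add: add_nonneg_pos)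
  have "ln ?r \<le> lam * real T / (8 * real k)"
    using T k lam_pos by (simp add: field_simps)
  then have "exp (- (lam * real T / (8 * real k))) \<le> exp (- ln ?r)" by simp
  also have "\<dots> = 1 / ?r" by (simp only: exp_minus exp_ln[OF r] inverse_eq_divide)
  finally have "(real L + 1) * (4 * real k) * exp (- (lam * real T / (8 * real k)))
      \<le> (real L + 1) * (4 * real k) * (1 / ?r)"
    using k by (intro mult_left_mono) auto
  also have "\<dots> = \<delta> / 2" using k \<delta> by (simp add: divide_simps) (simp add: algebra_simps)?
  finally have 1: "(real L + 1) * (4 * real k) * exp (- (lam * real T / (8 * real k))) \<le> \<delta> / 2" .
  have "exp (2 * real T * (real L + 1) - y) \<le> exp (- ln (2 / \<delta>))"
    using y by simp
  also have "\<dots> = \<delta> / 2" using \<delta> by (simp add: exp_minus)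
  finally show ?thesis
    using prob_success[where L=L and T=T and y=y] 1 by linarith
qed

lemma VS_error_le_weaken: "VS_error_le F P \<epsilon> \<omega> m \<Longrightarrow> \<epsilon> \<le> \<epsilon>' \<Longrightarrow> VS_error_le F P \<epsilon>' \<omega> m"
  unfolding VS_error_le_def by (meson order_trans)

text \<open>If fewer than \<open>n\<close> queries are made by time \<open>2 ^ L * T\<close>, the
  \<open>n\<close>-th one can only come later, when the version space is already accurate.\<close>

lemma label_complexity_le:
  assumes \<delta>: "0 < \<delta>" and L: "1 / 2 ^ L \<le> \<epsilon>"
    and T: "8 * real k / lam * ln (8 * real k * (real L + 1) / \<delta>) \<le> real T"
    and n: "2 * real T * (real L + 1) + ln (2 / \<delta>) \<le> real n" "1 \<le> n"
  shows "label_complexity X F P \<epsilon> \<delta> \<le> enat n"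
proof -
  interpret I: prob_space iid by (rule prob_space_iid)
  \<comment> \<open>For arbitrary confidence \<open>\<eta>\<close> the depth \<open>L\<close> is
    kept and only the base length is enlarged.\<close>
  have consistent: "\<exists>T. I.prob {\<omega> \<in> space iid. VS_error_le F P \<epsilon> \<omega> (enat T)} \<ge> 1 - \<eta>" if \<eta>: "0 < \<eta>" for \<eta>
  proof -
    define T where "T = nat \<lceil>8 * real k / lam * ln (8 * real k * (real L + 1) / \<eta>)\<rceil>"
    have "8 * real k / lam * ln (8 * real k * (real L + 1) / \<eta>) \<le> real T"
      unfolding T_def by (rule real_nat_ceiling_ge)
    from prob_success_ge[OF \<eta> this order_refl]
    have "1 - \<eta> \<le> I.prob {\<omega> \<in> space iid. VS_error_le F P (1 / 2 ^ L) \<omega> (enat (2 ^ L * T))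
      \<and> real (num_queries X F \<omega> (2 ^ L * T)) < 2 * real T * (real L + 1) + ln (2 / \<eta>)}" .
    also have "\<dots> \<le> I.prob {\<omega> \<in> space iid. VS_error_le F P \<epsilon> \<omega> (enat (2 ^ L * T))}"
      by (rule I.finite_measure_mono) (use L in \<open>auto intro: VS_error_le_weaken\<close>)
    finally show ?thesis by blast
  qed
  have "1 - \<delta> \<le> I.prob {\<omega> \<in> space iid. VS_error_le F P (1 / 2 ^ L) \<omega> (enat (2 ^ L * T))
      \<and> real (num_queries X F \<omega> (2 ^ L * T)) < real n}"
    by (rule prob_success_ge[OF \<delta> T n(1)])
  also have "\<dots> \<le> I.prob {\<omega> \<in> space iid. \<forall>m\<ge>1. num_queries X F \<omega> m = n \<longrightarrow> VS_error_le F P \<epsilon> \<omega> (enat m)}"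
  proof (rule I.finite_measure_mono)
    show "{\<omega> \<in> space iid. VS_error_le F P (1 / 2 ^ L) \<omega> (enat (2 ^ L * T))
        \<and> real (num_queries X F \<omega> (2 ^ L * T)) < real n}
      \<subseteq> {\<omega> \<in> space iid. \<forall>m\<ge>1. num_queries X F \<omega> m = n \<longrightarrow> VS_error_le F P \<epsilon> \<omega> (enat m)}"
    proof (safe, goal_cases)
      case (1 \<omega> m)
      have "2 ^ L * T \<le> m"
      proof (rule ccontr)
        assume "\<not> 2 ^ L * T \<le> m"
        then have "num_queries X F \<omega> m \<le> num_queries X F \<omega> (2 ^ L * T)"
          by (intro num_queries_mono) simp
        with 1 show False by simp
      qed
      then have "VS_error_le F P (1 / 2 ^ L) \<omega> (enat m)"
        using 1(2) by (auto intro: VS_error_le_mono)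
      then show ?case using L by (rule VS_error_le_weaken)
    qed
  qed measurable
  also have "\<dots> = measure (completion iid)
      {\<omega> \<in> space iid. (SUP h \<in> VS F (sample \<omega> (query_time X F \<omega> n)). ereal (er P h)) \<le> ereal \<epsilon>}"
    using measure_completion_query_time[OF consistent, of n] by (simp only: SUP_er_le_iff)
  finally show ?thesis
    unfolding label_complexity_def using n(2) by (intro Inf_lower) auto
qed

end

section \<open>The bound\<close>

text \<open>Pure real arithmetic: it chooses the depth \<open>L\<close>, the base length
  \<open>T\<close> and the budget \<open>n\<close>, and absorbs all additive constants into the two
  logarithms.\<close>

lemma scale_selection:
  "\<exists>c::real. c > 0 \<and> (\<forall>(k::nat) (lam::real) (\<epsilon>::real) (\<delta>::real).
     k \<ge> 1 \<longrightarrow> 0 < lam \<longrightarrow> lam < 1 \<longrightarrow> 0 < \<epsilon> \<longrightarrow> \<epsilon> < 1 / 2 \<longrightarrow> 0 < \<delta> \<longrightarrow> \<delta> < 1 / 2 \<longrightarrow>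
     0 \<le> c * (real k / lam) * ln (real k / \<delta> * ln (1 / \<epsilon>)) * ln (real k / \<epsilon> * ln (1 / \<delta>)) \<and>
     (\<exists>L T n. 1 / 2 ^ L \<le> \<epsilon> \<and>
       8 * real k / lam * ln (8 * real k * (real L + 1) / \<delta>) \<le> real T \<and>
       2 * real T * (real L + 1) + ln (2 / \<delta>) \<le> real n \<and> 1 \<le> n \<and>
       real n \<le> c * (real k / lam) * ln (real k / \<delta> * ln (1 / \<epsilon>)) * ln (real k / \<epsilon> * ln (1 / \<delta>))))"
proof -
  \<comment> \<open>A common positive lower bound of both logarithms, whose arguments are at least
    \<open>2 * ln 2 > 1\<close>.\<close>
  define \<kappa> where "\<kappa> = ln (2 * ln 2 :: real)"
  have "exp (1 / 2) < (2::real)"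
  proof (rule power2_less_imp_less)
    show "exp (1 / 2) ^ 2 < (2::real) ^ 2"
      using exp_le by (simp flip: exp_of_nat_mult)
  qed simp
  then have ln2_gt: "1 / 2 < ln (2::real)"
    by (metis exp_less_cancel_iff exp_ln zero_less_numeral)
  have ln2_le: "ln (2::real) \<le> 1" using ln_le_minus_one[of 2] by simp
  have \<kappa>: "0 < \<kappa>" unfolding \<kappa>_def using ln2_gt by (intro ln_gt_zero) simp
  \<comment> \<open>With \<open>E\<close>, \<open>x\<close>, \<open>y\<close>, \<open>g\<close> and
    \<open>r\<close> as defined below, the constants serve \<open>L + 1 \<le> K0 * E\<close>,
    \<open>ln r \<le> K1 * ln x\<close>, \<open>T \<le> K2 * (g * ln x)\<close>,
    \<open>E \<le> K3 * ln y\<close> and \<open>ln (2 / \<delta>) \<le> K4 * ln x\<close>.\<close>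
  define K0 where "K0 = 3 / ln (2::real)"
  define K1 where "K1 = ln (8 * K0) / \<kappa> + 1"
  define K2 where "K2 = 8 * K1 + 1 / \<kappa>"
  define K3 where "K3 = 1 - ln (ln 2) / \<kappa>"
  define K4 where "K4 = ln (2 / ln 2) / \<kappa> + 1"
  \<comment> \<open>The three summands pay for \<open>2 * T * (L + 1)\<close>, for
    \<open>ln (2 / \<delta>)\<close> and for rounding \<open>n\<close> up.\<close>
  define c where "c = 2 * K2 * (K0 * K3) + K4 / \<kappa> + 1 / \<kappa>\<^sup>2"
  have K0: "3 \<le> K0" using ln2_le ln2_gt by (simp add: K0_def field_simps)
  have K1: "1 \<le> K1" using K0 \<kappa> by (simp add: K1_def)
  have K2: "0 < K2" using K1 \<kappa> by (simp add: K2_def add_pos_pos)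
  have K3: "1 \<le> K3"
  proof -
    have "ln (ln 2) \<le> (0::real)" using ln2_le ln2_gt by simp
    then have "ln (ln 2) / \<kappa> \<le> 0" using \<kappa> by (simp add: divide_nonpos_pos)
    then show ?thesis by (simp add: K3_def)
  qed
  have K4: "1 \<le> K4"
  proof -
    have "0 \<le> ln (2 / ln (2::real))" using ln2_le ln2_gt by (intro ln_ge_zero) (simp add: field_simps)
    then show ?thesis using \<kappa> by (simp add: K4_def)
  qed
  have c: "0 < c"
    unfolding c_def using K0 K2 K3 K4 \<kappa> by (intro add_pos_pos mult_pos_pos divide_pos_pos) auto
  have main: "0 \<le> c * (real k / lam) * ln (real k / \<delta> * ln (1 / \<epsilon>)) * ln (real k / \<epsilon> * ln (1 / \<delta>)) \<and>
     (\<exists>L T n. 1 / 2 ^ L \<le> \<epsilon> \<and>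
       8 * real k / lam * ln (8 * real k * (real L + 1) / \<delta>) \<le> real T \<and>
       2 * real T * (real L + 1) + ln (2 / \<delta>) \<le> real n \<and> 1 \<le> n \<and>
       real n \<le> c * (real k / lam) * ln (real k / \<delta> * ln (1 / \<epsilon>)) * ln (real k / \<epsilon> * ln (1 / \<delta>)))"
    if k: "k \<ge> 1" and lam: "0 < lam" "lam < 1" and \<epsilon>: "0 < \<epsilon>" "\<epsilon> < 1 / 2" and \<delta>: "0 < \<delta>" "\<delta> < 1 / 2"
    for k :: nat and lam \<epsilon> \<delta> :: real
  proof -
    have k': "1 \<le> real k" using k by simp
    have logs: "ln 2 \<le> ln (1 / \<epsilon>)" "ln 2 \<le> ln (1 / \<delta>)"
      using \<epsilon> \<delta> by (auto intro!: ln_mono simp: field_simps)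
    have large: "2 * ln 2 \<le> real k / e * l" "1 / e * ln 2 \<le> real k / e * l"
      if "0 < e" "e < 1 / 2" "ln 2 \<le> l" for e l
    proof -
      have "2 \<le> 1 / e" "1 / e \<le> real k / e" using that k' by (auto simp: field_simps)
      then have "2 \<le> real k / e" "1 / e \<le> real k / e" by auto
      then show "2 * ln 2 \<le> real k / e * l" "1 / e * ln 2 \<le> real k / e * l"
        using that ln2_gt by (intro mult_mono; simp)+
    qed
    define E where "E = ln (1 / \<epsilon>)"
    define x where "x = real k / \<delta> * E"
    define y where "y = real k / \<epsilon> * ln (1 / \<delta>)"
    define g where "g = real k / lam"
    have E: "ln 2 \<le> E" using logs by (simp add: E_def)
    have x: "2 * ln 2 \<le> x" "1 / \<delta> * ln 2 \<le> x" and y: "2 * ln 2 \<le> y" "1 / \<epsilon> * ln 2 \<le> y"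
      unfolding x_def y_def using large[OF \<delta> E] large[OF \<epsilon> logs(2)] by auto
    have x0: "0 < x" and y0: "0 < y" using x(1) y(1) ln2_gt by linarith+
    have lx: "\<kappa> \<le> ln x" and ly: "\<kappa> \<le> ln y"
      unfolding \<kappa>_def using x y ln2_gt by (auto intro!: ln_mono)
    have lx0: "0 < ln x" "0 < ln y" using lx ly \<kappa> by linarith+
    \<comment> \<open>Turns a nonnegative constant into a multiple of a logarithm that is at least
      \<open>\<kappa>\<close>.\<close>
    have const: "u \<le> u / \<kappa> * ln z" if "0 \<le> u" "\<kappa> \<le> ln z" for u z
      using mult_left_mono[of \<kappa> "ln z" "u / \<kappa>"] that \<kappa> by simp
    have g: "1 \<le> g" using k' lam by (simp add: g_def field_simps)
    \<comment> \<open>From \<open>y \<ge> ln 2 / \<epsilon>\<close>; the negative term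
      \<open>ln (ln 2)\<close> is moved to the other side and absorbed.\<close>
    have E_le: "E \<le> K3 * ln y"
    proof -
      have "E + ln (ln 2) = ln (1 / \<epsilon> * ln 2)"
        unfolding E_def using \<epsilon> ln2_gt by (subst ln_mult_pos) auto
      also have "\<dots> \<le> ln y" using y(2) \<epsilon> ln2_gt by (intro ln_mono) auto
      finally have "E \<le> ln y + (- ln (ln 2))" by simp
      also have "\<dots> \<le> ln y + (- ln (ln 2)) / \<kappa> * ln y"
        using ln2_le ln2_gt ly by (intro add_left_mono const) auto
      finally show ?thesis by (simp add: K3_def algebra_simps)
    qed
    define L where "L = nat \<lceil>log 2 (1 / \<epsilon>)\<rceil>"
    have logE: "log 2 (1 / \<epsilon>) = E / ln 2" by (simp add: log_def E_def)
    have L1: "real L + 1 \<le> K0 * E"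
    proof -
      have "1 \<le> E / ln 2" using E ln2_gt by (simp add: field_simps)
      moreover have "real L \<le> E / ln 2 + 1"
        unfolding L_def logE using calculation by linarith
      ultimately have "real L + 1 \<le> 3 * (E / ln 2)" by linarith
      then show ?thesis by (simp add: K0_def)
    qed
    have L2: "1 / 2 ^ L \<le> \<epsilon>"
    proof -
      have "1 / \<epsilon> = 2 powr (log 2 (1 / \<epsilon>))" using \<epsilon> by simp
      also have "\<dots> \<le> 2 powr (real L)"
        unfolding L_def by (intro powr_mono real_nat_ceiling_ge) auto
      finally have "1 / \<epsilon> \<le> 2 ^ L" by (simp add: powr_realpow)
      then show ?thesis using \<epsilon> by (simp add: field_simps)
    qed
    define r where "r = 8 * real k * (real L + 1) / \<delta>"
    have r1: "1 \<le> r"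
    proof -
      have "1 * 1 \<le> 8 * real k * (real L + 1)" using k' by (intro mult_mono) auto
      then show ?thesis using \<delta> by (simp add: r_def field_simps)
    qed
    have lr: "ln r \<le> K1 * ln x"
    proof -
      have "r \<le> 8 * real k * (K0 * E) / \<delta>"
        unfolding r_def using L1 \<delta> by (intro divide_right_mono mult_left_mono) auto
      also have "\<dots> = 8 * K0 * x" by (simp add: x_def)
      finally have "ln r \<le> ln (8 * K0 * x)" using r1 by (intro ln_mono) auto
      also have "\<dots> = ln (8 * K0) + ln x" using K0 x0 by (subst ln_mult_pos) auto
      also have "\<dots> \<le> ln (8 * K0) / \<kappa> * ln x + ln x"
        using K0 lx by (intro add_right_mono const) auto
      finally show ?thesis by (simp add: K1_def algebra_simps)
    qed
    define T where "T = nat \<lceil>8 * g * ln r\<rceil>"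
    have T1: "8 * g * ln r \<le> real T" unfolding T_def by (rule real_nat_ceiling_ge)
    have T2: "real T \<le> K2 * (g * ln x)"
    proof -
      have "0 \<le> 8 * g * ln r" using g r1 by simp
      then have "real T \<le> 8 * g * ln r + 1" unfolding T_def by linarith
      also have "\<dots> \<le> 8 * g * (K1 * ln x) + g * (1 / \<kappa> * ln x)"
      proof (rule add_mono)
        show "8 * g * ln r \<le> 8 * g * (K1 * ln x)" using lr g by (intro mult_left_mono) auto
        have "1 * 1 \<le> g * (1 / \<kappa> * ln x)" using g const[of 1 x] lx by (intro mult_mono) auto
        then show "1 \<le> g * (1 / \<kappa> * ln x)" by simp
      qed
      finally show ?thesis by (simp add: K2_def algebra_simps)
    qed
    have l\<delta>: "ln (2 / \<delta>) \<le> K4 * ln x"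
    proof -
      have "2 / \<delta> = 2 / ln 2 * (1 / \<delta> * ln 2)" using ln2_gt by simp
      also have "\<dots> \<le> 2 / ln 2 * x" using x(2) ln2_gt by (intro mult_left_mono) auto
      finally have "ln (2 / \<delta>) \<le> ln (2 / ln 2 * x)" using \<delta> by (intro ln_mono) auto
      also have "\<dots> = ln (2 / ln 2) + ln x" using x0 ln2_gt by (subst ln_mult_pos) auto
      also have "\<dots> \<le> ln (2 / ln 2) / \<kappa> * ln x + ln x"
      proof -
        have "0 \<le> ln (2 / ln (2::real))" using ln2_le ln2_gt by (intro ln_ge_zero) (simp add: field_simps)
        then show ?thesis using lx by (intro add_right_mono const) auto
      qed
      finally show ?thesis by (simp add: K4_def algebra_simps)
    qed
    define n where "n = nat \<lceil>2 * real T * (real L + 1) + ln (2 / \<delta>)\<rceil>"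
    have n1: "2 * real T * (real L + 1) + ln (2 / \<delta>) \<le> real n"
      unfolding n_def by (rule real_nat_ceiling_ge)
    have "0 < ln (2 / \<delta>)" using \<delta> by (intro ln_gt_zero) (simp add: field_simps)
    then have pos: "0 < 2 * real T * (real L + 1) + ln (2 / \<delta>)" by (intro add_nonneg_pos) auto
    then have n2: "1 \<le> n" using n1 by linarith
    have "real n \<le> 2 * real T * (real L + 1) + ln (2 / \<delta>) + 1"
      unfolding n_def using pos by linarith
    also have "\<dots> \<le> 2 * (K2 * (g * ln x)) * (K0 * (K3 * ln y))
        + K4 * (g * ln x) * (1 / \<kappa> * ln y) + (1 / \<kappa> * (g * ln x)) * (1 / \<kappa> * ln y)"
    proof (intro add_mono)
      have "K0 * E \<le> K0 * (K3 * ln y)" using E_le K0 by (intro mult_left_mono) auto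
      with L1 have "real L + 1 \<le> K0 * (K3 * ln y)" by linarith
      then show "2 * real T * (real L + 1) \<le> 2 * (K2 * (g * ln x)) * (K0 * (K3 * ln y))"
        using T2 K2 g lx0 by (intro mult_mono) auto
      have one: "1 \<le> 1 / \<kappa> * ln y" using const[of 1 y] ly by simp
      have gx: "ln x \<le> g * ln x" using g lx0 by (simp add: mult_le_cancel_right1)
      have "K4 * ln x * 1 \<le> K4 * (g * ln x) * (1 / \<kappa> * ln y)"
        using K4 gx one lx0 g by (intro mult_mono) auto
      with l\<delta> show "ln (2 / \<delta>) \<le> K4 * (g * ln x) * (1 / \<kappa> * ln y)" by linarith
      have "1 \<le> 1 / \<kappa> * ln x" using const[of 1 x] lx by simp
      also have "\<dots> \<le> 1 / \<kappa> * (g * ln x)" using gx \<kappa> by (intro mult_left_mono) auto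
      finally have "1 * 1 \<le> (1 / \<kappa> * (g * ln x)) * (1 / \<kappa> * ln y)"
        using one by (intro mult_mono) auto
      then show "1 \<le> (1 / \<kappa> * (g * ln x)) * (1 / \<kappa> * ln y)" by simp
    qed
    also have "\<dots> = c * g * ln x * ln y"
      by (simp add: c_def algebra_simps power2_eq_square)
    finally have n3: "real n \<le> c * g * ln x * ln y" .
    have "0 \<le> c * g * ln x * ln y" using c g lx0 by simp
    moreover have "8 * real k / lam * ln (8 * real k * (real L + 1) / \<delta>) \<le> real T"
      using T1 by (simp add: g_def r_def)
    ultimately show ?thesis
      using L2 n1 n2 n3 unfolding x_def y_def g_def E_def by blast
  qed
  with c show ?thesis by blast
qed

text \<open>The last factor of the bound is at least 1, also when the quotient is infinite, so it
  can be multiplied in at the end.\<close>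

lemma ereal_ln_max_exp_ge: "1 \<le> ereal_ln (max q (ereal (exp 1)))"
proof (cases "max q (ereal (exp 1))")
  case (real r)
  then have "ereal (exp 1) \<le> ereal r" by (metis max.cobounded2)
  then have "exp 1 \<le> r" by simp
  then have "ln (exp 1) \<le> ln r" by (intro ln_mono) auto
  with real show ?thesis by (simp add: ereal_ln_def one_ereal_def)
next
  case MInf
  then have "ereal (exp 1) \<le> - \<infinity>" by (metis max.cobounded2)
  then show ?thesis by simp
qed (simp add: ereal_ln_def)

theorem corollary14:
  shows "\<exists>c::real. c > 0 \<and>
    (\<forall>(k::nat) (lam::real) (P :: ((nat \<Rightarrow> real) \<times> int) measure) (\<epsilon>::real) (\<delta>::real).
       k \<ge> 1 \<longrightarrow> 0 < lam \<longrightarrow> lam < 1 \<longrightarrow>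
       prob_space P \<longrightarrow> sets P = sets (instance_space k \<Otimes>\<^sub>M label_space) \<longrightarrow>
       continuous_product_distribution k (distr P (instance_space k) fst) \<longrightarrow>
       realizable P (heavy_rectangles k lam P) \<longrightarrow>
       0 < \<epsilon> \<longrightarrow> \<epsilon> < 1 / 2 \<longrightarrow> 0 < \<delta> \<longrightarrow> \<delta> < 1 / 2 \<longrightarrow>
       ereal_of_enat
         (label_complexity (space (instance_space k)) (heavy_rectangles k lam P) P \<epsilon> \<delta>)
       \<le> ereal (c * (real k / lam)
                  * ln (real k / \<delta> * ln (1 / \<epsilon>))
                  * ln (real k / \<epsilon> * ln (1 / \<delta>)))
          * ereal_ln (max (ereal (lam * ln (1 / \<epsilon>)) / ereal (\<epsilon> * ln (real k))) (ereal (exp 1))))"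
proof -
  obtain c :: real where c: "c > 0" and select: "\<And>(k::nat) (lam::real) (\<epsilon>::real) (\<delta>::real).
     k \<ge> 1 \<Longrightarrow> 0 < lam \<Longrightarrow> lam < 1 \<Longrightarrow> 0 < \<epsilon> \<Longrightarrow> \<epsilon> < 1 / 2 \<Longrightarrow> 0 < \<delta> \<Longrightarrow> \<delta> < 1 / 2 \<Longrightarrow>
     0 \<le> c * (real k / lam) * ln (real k / \<delta> * ln (1 / \<epsilon>)) * ln (real k / \<epsilon> * ln (1 / \<delta>)) \<and>
     (\<exists>L T n. 1 / 2 ^ L \<le> \<epsilon> \<and>
       8 * real k / lam * ln (8 * real k * (real L + 1) / \<delta>) \<le> real T \<and>
       2 * real T * (real L + 1) + ln (2 / \<delta>) \<le> real n \<and> 1 \<le> n \<and>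
       real n \<le> c * (real k / lam) * ln (real k / \<delta> * ln (1 / \<epsilon>)) * ln (real k / \<epsilon> * ln (1 / \<delta>)))"
    using scale_selection by blast
  show ?thesis
  proof (intro exI[of _ c] conjI c allI impI)
    fix k :: nat and lam :: real and P :: "((nat \<Rightarrow> real) \<times> int) measure" and \<epsilon> \<delta> :: real
    assume k: "k \<ge> 1" and lam: "0 < lam" "lam < 1"
      and P: "prob_space P" "sets P = sets (instance_space k \<Otimes>\<^sub>M label_space)"
      and D: "continuous_product_distribution k (distr P (instance_space k) fst)"
      and realizable: "realizable P (heavy_rectangles k lam P)"
      and \<epsilon>: "0 < \<epsilon>" "\<epsilon> < 1 / 2" and \<delta>: "0 < \<delta>" "\<delta> < 1 / 2"
    obtain \<mu> where \<mu>: "\<And>j. j < k \<Longrightarrow> real_distribution (\<mu> j) \<and> continuous_on UNIV (cdf (\<mu> j))"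
      and marginal: "distr P (instance_space k) fst = (\<Pi>\<^sub>M j\<in>{..<k}. \<mu> j)"
      using D unfolding continuous_product_distribution_def by blast
    obtain a b where target: "rectangle k a b \<in> heavy_rectangles k lam P"
      "AE z in P. snd z = rectangle k a b (fst z)"
      using realizable unfolding realizable_def by (auto simp: heavy_rectangles_def rectangles_eq)
    \<comment> \<open>The family of marginals is continued by \<open>\<mu> 0\<close>, available
      because \<open>k \<ge> 1\<close>, so that every index carries a law with continuous
      CDF.\<close>
    define \<mu>' where "\<mu>' j = (if j < k then \<mu> j else \<mu> 0)" for j
    have \<mu>': "real_distribution (\<mu>' j)" "continuous_on UNIV (cdf (\<mu>' j))" for j
      using \<mu>[of j] \<mu>[of 0] k by (auto simp: \<mu>'_def)
    have marginal': "distr P (instance_space k) fst = (\<Pi>\<^sub>M j\<in>{..<k}. \<mu>' j)"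
      unfolding marginal by (intro PiM_cong) (auto simp: \<mu>'_def)
    interpret prob_space P by (rule P)
    interpret product_rectangle_learning k lam P \<mu>' a b
      by (intro product_rectangle_learning.intro rectangle_learning.intro
        rectangle_learning_axioms.intro product_rectangle_learning_axioms.intro
        P \<mu>' marginal' k lam(1) target)
    obtain L T n where "1 / 2 ^ L \<le> \<epsilon>"
      "8 * real k / lam * ln (8 * real k * (real L + 1) / \<delta>) \<le> real T"
      "2 * real T * (real L + 1) + ln (2 / \<delta>) \<le> real n" "1 \<le> n"
      and n: "real n \<le> c * (real k / lam) * ln (real k / \<delta> * ln (1 / \<epsilon>)) * ln (real k / \<epsilon> * ln (1 / \<delta>))"
      using select[OF k lam \<epsilon> \<delta>] by blast
    then have "label_complexity X F P \<epsilon> \<delta> \<le> enat n"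
      by (intro label_complexity_le \<delta>(1))
    then have "ereal_of_enat (label_complexity X F P \<epsilon> \<delta>) \<le> ereal_of_enat (enat n)"
      by (simp only: ereal_of_enat_le_iff)
    also have "\<dots> \<le> ereal (c * (real k / lam) * ln (real k / \<delta> * ln (1 / \<epsilon>)) * ln (real k / \<epsilon> * ln (1 / \<delta>))) * 1"
      using n by simp
    \<comment> \<open>The product of the other factors is nonnegative, so the factor 1 may be
      enlarged to the last logarithm.\<close>
    also have "\<dots> \<le> ereal (c * (real k / lam) * ln (real k / \<delta> * ln (1 / \<epsilon>)) * ln (real k / \<epsilon> * ln (1 / \<delta>)))
        * ereal_ln (max (ereal (lam * ln (1 / \<epsilon>)) / ereal (\<epsilon> * ln (real k))) (ereal (exp 1)))"
      using select[OF k lam \<epsilon> \<delta>] by (intro ereal_mult_left_mono ereal_ln_max_exp_ge) simp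
    finally show "ereal_of_enat
         (label_complexity (space (instance_space k)) (heavy_rectangles k lam P) P \<epsilon> \<delta>)
       \<le> ereal (c * (real k / lam)
                  * ln (real k / \<delta> * ln (1 / \<epsilon>))
                  * ln (real k / \<epsilon> * ln (1 / \<delta>)))
          * ereal_ln (max (ereal (lam * ln (1 / \<epsilon>)) / ereal (\<epsilon> * ln (real k))) (ereal (exp 1)))" .
  qed
qed

end
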